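(* Let $d\in\mathbb{N}$ and let $k\in\{2,3\}$. If $k=2$ assume $d\ge 4$; if $k=3$ assume $d\ge 6$. Let $\Omega=\Omega_1\times\cdots\times\Omega_d\subset\mathbb{R}^d$, where each $\Omega_j\subset\mathbb{R}$ is an interval symmetric about $0$ (possibly unbounded), and let $\varrho(\mathbf{x})=\varrho_1(x_1)\cdots\varrho_d(x_d)$, where each $\varrho_j:\Omega_j\to[0,\infty)$ satisfies $\varrho_j(x)=\varrho_j(-x)$ and all univariate polynomials are integrable with respect to $\varrho_j(x)\,dx$ on $\Omega_j$. Then there exists a cubature formula $Q_n$ for the integral $$I_d^\varrho(f)=\int_\Omega f(\mathbf{x})\,\varrho(\mathbf{x})\,d\mathbf{x}$$ with degree $2k+1$ of exactness whose number $n$ of knots is at most $$d^2+9d+1\quad\text{if }k=2,\qquad\text{and}\qquad \frac{d^3+33d^2+14d+3}{3}\quad\text{if }k=3.$$ If, in addition, the one-dimensional weight functions are all equal, $\varrho_1=\cdots=\varrho_d$ (as functions on a common interval $\Omega_1=\cdots=\Omega_d$), then there exists a cubature formula for $I_d^\varrho$ with degree $2k+1$ of exactness whose number of knots is at most $$d^2+7d+1\quad\text{if }k=2,\qquad\text{and}\qquad \frac{d^3+21d^2+20d+3}{3}\quad\text{if }k=3.$$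
   Context: A cubature formula with $n$ knots for $I_d^\varrho$ is a functional $Q_n(f)=\sum_{i=1}^n a_i f(\mathbf{x}_i)$ with real (possibly negative) weights $a_i\in\mathbb{R}$ and knots $\mathbf{x}_i\in\Omega$. Let $\mathbb{P}(\ell,d)$ be the space of all real polynomials in $d$ variables of total degree at most $\ell$. The formula $Q_n$ has degree $\ell$ of exactness (for $I_d^\varrho$) if $Q_n(f)=I_d^\varrho(f)$ for all $f\in\mathbb{P}(\ell,d)$. *)

theory Defs
  imports "HOL-Analysis.Analysis" "HOL-Computational_Algebra.Polynomial"
begin

definition multi_indices :: "nat \<Rightarrow> ('d::finite \<Rightarrow> nat) set"
  where "multi_indices l = {\<alpha>. (\<Sum>j\<in>UNIV. \<alpha> j) \<le> l}"

lemma finite_multi_indices: "finite (multi_indices l :: ('d::finite \<Rightarrow> nat) set)"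
proof (rule finite_subset)
  show "(multi_indices l :: ('d \<Rightarrow> nat) set) \<subseteq> PiE UNIV (\<lambda>_. {..l})"
  proof
    fix \<alpha> :: "'d \<Rightarrow> nat"
    assume "\<alpha> \<in> multi_indices l"
    then have "\<alpha> j \<le> l" for j
      using member_le_sum[of j UNIV \<alpha>] by (auto simp: multi_indices_def)
    then show "\<alpha> \<in> PiE UNIV (\<lambda>_. {..l})" by auto
  qed
  show "finite (PiE (UNIV :: 'd set) (\<lambda>_. {..l}))"
    by (rule finite_PiE) auto
qed

text \<open>Real polynomials in \<open>d = CARD('d)\<close> variables of total degree at most \<open>l\<close>, as functions;
  over the reals a polynomial is determined by its function.\<close>

definition poly_space :: "nat \<Rightarrow> (real ^ 'd \<Rightarrow> real) set"
  where "poly_space l =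
    {f. \<exists>c :: ('d \<Rightarrow> nat) \<Rightarrow> real.
          f = (\<lambda>x. \<Sum>\<alpha>\<in>multi_indices l. c \<alpha> * (\<Prod>j\<in>UNIV. (x $ j) ^ \<alpha> j))}"

definition box_domain :: "('d \<Rightarrow> real set) \<Rightarrow> (real ^ 'd) set"
  where "box_domain \<Omega> = {x. \<forall>j. x $ j \<in> \<Omega> j}"

definition product_weight :: "('d \<Rightarrow> real \<Rightarrow> real) \<Rightarrow> real ^ 'd \<Rightarrow> real"
  where "product_weight \<rho> x = (\<Prod>j\<in>UNIV. \<rho> j (x $ j))"

definition weighted_integral ::
    "(real ^ 'd) set \<Rightarrow> (real ^ 'd \<Rightarrow> real) \<Rightarrow> (real ^ 'd \<Rightarrow> real) \<Rightarrow> real"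
  where "weighted_integral D w f = (LINT x:D|lebesgue. f x * w x)"

definition cubature_formula ::
    "(real ^ 'd) set \<Rightarrow> nat \<Rightarrow> ((real ^ 'd \<Rightarrow> real) \<Rightarrow> real) \<Rightarrow> bool"
  where "cubature_formula D n Q \<longleftrightarrow>
    (\<exists>(a :: nat \<Rightarrow> real) (x :: nat \<Rightarrow> real ^ 'd).
       (\<forall>i\<in>{1..n}. x i \<in> D) \<and> Q = (\<lambda>f. \<Sum>i=1..n. a i * f (x i)))"

definition exact_of_degree ::
    "nat \<Rightarrow> ((real ^ 'd \<Rightarrow> real) \<Rightarrow> real) \<Rightarrow> ((real ^ 'd \<Rightarrow> real) \<Rightarrow> real) \<Rightarrow> bool"
  where "exact_of_degree l I Q \<longleftrightarrow> (\<forall>f\<in>poly_space l. Q f = I f)"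

end

theory Submission
  imports Defs
begin

text \<open>
  For a functional \<open>Q\<close> on polynomials, the values \<open>Q ((c \<bullet> x) ^ m)\<close>, as a function of \<open>c\<close>, determine \<open>Q\<close> on all
  monomials of degree \<open>m\<close>, because powers of linear forms span the homogeneous polynomials. Write
  \<open>p\<^sub>k(c) = \<Sum>\<^sub>j c\<^sub>j ^ k\<close>. If this function of \<open>c\<close> involves only power sums of even order, it does not change under
  \<open>c\<^sub>i \<mapsto> - c\<^sub>i\<close>, so \<open>Q\<close> annihilates every monomial with an odd exponent, just as the integral against a symmetric
  product weight does (\<open>vanishes_on_odd_monomials\<close>).

  Such functionals come from orbits of the symmetric group. The antipodal orbit of \<open>\<Sum>i\<in>S. e\<^sub>i\<close> with \<open>card S = k\<close> has
  \<open>2 * (d choose k)\<close> knots, which is the leading term of the bounds, and its power function of degree \<open>2 * k\<close> contains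
  \<open>p\<^sub>2 ^ k\<close>, the term that detects \<open>x\<^sub>i\<^sup>2 x\<^sub>j\<^sup>2\<close> or \<open>x\<^sub>i\<^sup>2 x\<^sub>j\<^sup>2 x\<^sub>l\<^sup>2\<close>. For \<open>k = 2\<close> all unwanted terms are multiples of
  \<open>p\<^sub>1\<close>, and two orbits of points \<open>b * (1, ..., 1) + a * e\<^sub>i\<close> cancel them (\<open>main_part_degree_5\<close>). For \<open>k = 3\<close> the unwanted
  terms are multiples of \<open>p\<^sub>1\<close> and the term \<open>p\<^sub>3\<^sup>2\<close>. Three orbits of pairs remove \<open>p\<^sub>3\<^sup>2\<close> and \<open>p\<^sub>1 p\<^sub>2 p\<^sub>3\<close>
  without introducing \<open>p\<^sub>1\<^sup>2 p\<^sub>2\<^sup>2\<close>; what is left has the form \<open>p\<^sub>1 ^ j * p\<^sub>i\<close> and is killed by orbits with only \<open>O(d)\<close> knots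
  (\<open>cancel_power_sum_1_multiples\<close>, \<open>main_part_degree_7\<close>).

  Real weights of any sign are allowed, and so far only products of \<open>k\<close> squares have to be matched, so the design can be
  rescaled freely. Stretching
  coordinate \<open>j\<close> by the square root of its normalized second moment makes \<open>x\<^sub>i\<^sup>2 x\<^sub>j\<^sup>2\<close>, respectively
  \<open>x\<^sub>i\<^sup>2 x\<^sub>j\<^sup>2 x\<^sub>l\<^sup>2\<close>, exact, and a common shrinking factor, compensated by the weights, moves all knots into the domain
  (\<open>scaled_main_part\<close>). By degree, every other monomial with even exponents involves fewer than \<open>k\<close> coordinates. These are
  repaired in order of decreasing number of coordinates: knots in the coordinate subspace of \<open>S\<close> do not see monomials
  that involve a coordinate outside \<open>S\<close>, so a correction never spoils what was already exact (\<open>correct_support_size\<close>).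

  For \<open>k = 2\<close> the count is \<open>(d\<^sup>2 - d) + 4 d\<close> for the design, \<open>4 d\<close> on the axes and the origin: \<open>d\<^sup>2 + 7 d + 1\<close>,
  for arbitrary weights.
  For \<open>k = 3\<close> each coordinate plane needs \<open>g\<close> grids of four knots, \<open>g = 3\<close> in general and \<open>g = 2\<close> for equal weights,
  when the moments of \<open>x\<^sub>i ^ 4 * x\<^sub>j\<^sup>2\<close> and \<open>x\<^sub>i\<^sup>2 * x\<^sub>j ^ 4\<close> coincide. The total is
  \<open>d (d - 1) (d - 2) / 3 + (6 + 4 g) * d (d - 1) / 2 + 18 d + 7\<close>. For \<open>g = 2\<close> it is within the required bound
  exactly when \<open>d\<^sup>2 \<ge> 5 d + 6\<close>, that is \<open>d \<ge> 6\<close>.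
\<close>

section \<open>Cubature formulas as functionals\<close>

lemma cubature_formula_zero: "cubature_formula D 0 (\<lambda>f. 0)"
  by (auto simp: cubature_formula_def)

lemma cubature_formula_point:
  assumes "x \<in> D"
  shows "cubature_formula D 1 (\<lambda>f. f x)"
  unfolding cubature_formula_def
  by (rule exI[of _ "\<lambda>_. 1"], rule exI[of _ "\<lambda>_. x"]) (use assms in auto)

lemma cubature_formula_add:
  assumes "cubature_formula D m Q" "cubature_formula D n R"
  shows "cubature_formula D (m + n) (\<lambda>f. Q f + R f)"
proof -
  obtain a x where ax: "\<forall>i\<in>{1..m}. x i \<in> D" "Q = (\<lambda>f. \<Sum>i=1..m. a i * f (x i))"
    using assms(1) unfolding cubature_formula_def by blast
  obtain b y where by': "\<forall>i\<in>{1..n}. y i \<in> D" "R = (\<lambda>f. \<Sum>i=1..n. b i * f (y i))"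
    using assms(2) unfolding cubature_formula_def by blast
  define c where "c i = (if i \<le> m then a i else b (i - m))" for i
  define z where "z i = (if i \<le> m then x i else y (i - m))" for i
  have "Q f + R f = (\<Sum>i=1..m+n. c i * f (z i))" for f
  proof -
    have "(\<Sum>i=1..m+n. c i * f (z i)) = (\<Sum>i=1..m. c i * f (z i)) + (\<Sum>i=m+1..m+n. c i * f (z i))"
      by (rule sum.ub_add_nat) simp
    also have "(\<Sum>i=1..m. c i * f (z i)) = Q f"
      by (simp add: ax c_def z_def)
    also have "(\<Sum>i=m+1..m+n. c i * f (z i)) = (\<Sum>i=1..n. c (i + m) * f (z (i + m)))"
      using sum.shift_bounds_cl_nat_ivl[of "\<lambda>i. c i * f (z i)" 1 m n] by (simp add: add.commute)
    also have "\<dots> = R f"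
      by (simp add: by' c_def z_def)
    finally show ?thesis by simp
  qed
  moreover have "\<forall>i\<in>{1..m+n}. z i \<in> D"
  proof
    fix i assume "i \<in> {1..m+n}"
    then have "i \<in> {1..m} \<or> \<not> i \<le> m \<and> i - m \<in> {1..n}" by auto
    then show "z i \<in> D" using ax(1) by'(1) by (auto simp: z_def)
  qed
  ultimately show ?thesis unfolding cubature_formula_def by blast
qed

lemma cubature_formula_scale:
  assumes "cubature_formula D n Q"
  shows "cubature_formula D n (\<lambda>f. w * Q f)"
proof -
  obtain a x where ax: "\<forall>i\<in>{1..n}. x i \<in> D" "Q = (\<lambda>f. \<Sum>i=1..n. a i * f (x i))"
    using assms(1) unfolding cubature_formula_def by blast
  then have "(\<lambda>f. w * Q f) = (\<lambda>f. \<Sum>i=1..n. (w * a i) * f (x i))"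
    by (simp add: sum_distrib_left mult.assoc)
  with ax(1) show ?thesis unfolding cubature_formula_def by (intro exI conjI)
qed

lemma cubature_formula_sum:
  assumes "finite A" "\<And>i. i \<in> A \<Longrightarrow> cubature_formula D n (Q i)"
  shows "cubature_formula D (card A * n) (\<lambda>f. \<Sum>i\<in>A. Q i f)"
  using assms
proof (induction A rule: finite_induct)
  case empty
  then show ?case by (simp add: cubature_formula_zero)
next
  case (insert i A)
  then have "cubature_formula D (n + card A * n) (\<lambda>f. Q i f + (\<Sum>i\<in>A. Q i f))"
    by (intro cubature_formula_add) auto
  with insert show ?case by simp
qed

lemma cubature_formula_comp:
  assumes "cubature_formula D n Q" "\<And>x. x \<in> D \<Longrightarrow> h x \<in> D'"
  shows "cubature_formula D' n (\<lambda>f. Q (\<lambda>x. f (h x)))"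
proof -
  obtain a x where ax: "\<forall>i\<in>{1..n}. x i \<in> D" "Q = (\<lambda>f. \<Sum>i=1..n. a i * f (x i))"
    using assms(1) unfolding cubature_formula_def by blast
  show ?thesis unfolding cubature_formula_def
    by (rule exI[of _ a], rule exI[of _ "\<lambda>i. h (x i)"]) (use ax assms(2) in auto)
qed

lemma cubature_formula_linear:
  assumes "cubature_formula D n Q"
  shows "Q (\<lambda>x. \<Sum>i\<in>A. c i * f i x) = (\<Sum>i\<in>A. c i * Q (f i))"
proof -
  obtain a x where ax: "Q = (\<lambda>f. \<Sum>i=1..n. a i * f (x i))"
    using assms(1) unfolding cubature_formula_def by blast
  show ?thesis
    unfolding ax by (simp add: sum_distrib_left) (subst sum.swap, simp add: mult_ac)
qed

lemma cubature_formula_mult: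
  assumes "cubature_formula D n Q"
  shows "Q (\<lambda>x. c * f x) = c * Q f"
  using cubature_formula_linear[OF assms, of "\<lambda>_. c" "\<lambda>_. f" "{()}"] by simp

text \<open>The finitely many knots \<open>h y\<close> are bounded, so a small multiple of all of them fits into any neighbourhood of the origin.\<close>

lemma cubature_formula_shrink:
  fixes Q :: "(real ^ 'd \<Rightarrow> real) \<Rightarrow> real" and h :: "real ^ 'd \<Rightarrow> real ^ 'd"
  assumes Q: "cubature_formula UNIV n Q" and D: "ball 0 \<epsilon> \<subseteq> D" "\<epsilon> > 0"
  obtains t where "t > 0" "cubature_formula D n (\<lambda>f. Q (\<lambda>y. f (t *\<^sub>R h y)))"
proof -
  obtain a x where ax: "Q = (\<lambda>f. \<Sum>i=1..n. a i * f (x i))"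
    using Q unfolding cubature_formula_def by blast
  define B where "B = (\<Sum>i=1..n. norm (h (x i)))"
  have B: "norm (h (x i)) \<le> B" if "i \<in> {1..n}" for i
    unfolding B_def by (rule member_le_sum) (use that in auto)
  have B0: "B \<ge> 0" unfolding B_def by (simp add: sum_nonneg)
  define t where "t = \<epsilon> / (B + 1)"
  have t: "t > 0" using B0 D(2) by (simp add: t_def)
  have "t *\<^sub>R h (x i) \<in> D" if "i \<in> {1..n}" for i
  proof -
    have "norm (t *\<^sub>R h (x i)) = t * norm (h (x i))" using t by simp
    also have "\<dots> \<le> t * B" using B[OF that] t by simp
    also have "\<dots> < t * (B + 1)" using t by simp
    also have "\<dots> = \<epsilon>" using B0 by (simp add: t_def)
    finally show ?thesis using D(1) by (auto simp: subset_iff)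
  qed
  then have "cubature_formula D n (\<lambda>f. Q (\<lambda>y. f (t *\<^sub>R h y)))"
    unfolding cubature_formula_def ax by (intro exI[of _ a] exI[of _ "\<lambda>i. t *\<^sub>R h (x i)"]) auto
  with t show ?thesis by (rule that)
qed

section \<open>Monomials and powers of linear forms\<close>

definition monomial :: "('d::finite \<Rightarrow> nat) \<Rightarrow> real ^ 'd \<Rightarrow> real"
  where "monomial \<alpha> x = (\<Prod>j\<in>UNIV. (x $ j) ^ \<alpha> j)"

definition total_degree :: "('d::finite \<Rightarrow> nat) \<Rightarrow> nat"
  where "total_degree \<alpha> = (\<Sum>j\<in>UNIV. \<alpha> j)"

text \<open>Polarization: replace \<open>c\<close> by \<open>c + t * e\<^sub>j\<close>. The result is a polynomial in \<open>t\<close> that vanishes identically, so its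
  coefficients vanish, and the coefficient of \<open>t ^ \<alpha>\<^sub>j\<close> has \<open>\<alpha>\<^sub>j\<close> factors \<open>c \<bullet> x\<close> turned into \<open>x\<^sub>j\<close>. Doing this for one
  coordinate after another produces the whole monomial.\<close>

lemma annihilates_powers_imp_annihilates_monomials:
  fixes Q :: "(real ^ 'd::finite \<Rightarrow> real) \<Rightarrow> real"
  assumes Q: "cubature_formula D n Q"
    and zero: "\<And>c. Q (\<lambda>x. (c \<bullet> x) ^ total_degree \<alpha>) = 0"
  shows "Q (monomial \<alpha>) = 0"
proof -
  let ?m = "total_degree \<alpha>"
  have "Q (\<lambda>x. (c \<bullet> x) ^ (?m - sum \<alpha> A) * (\<Prod>j\<in>A. (x $ j) ^ \<alpha> j)) = 0" if "finite A" for A c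
    using that
  proof (induction A arbitrary: c rule: finite_induct)
    case empty
    then show ?case by (simp add: zero)
  next
    case (insert j A)
    let ?N = "?m - sum \<alpha> A"
    have "sum \<alpha> (insert j A) \<le> ?m"
      unfolding total_degree_def by (rule sum_mono2) auto
    then have le: "\<alpha> j \<le> ?N" and eq: "?N - \<alpha> j = ?m - sum \<alpha> (insert j A)"
      using insert.hyps by auto
    let ?P = "\<lambda>x. \<Prod>j\<in>A. (x $ j) ^ \<alpha> j"
    let ?q = "\<lambda>k. Q (\<lambda>x. (c \<bullet> x) ^ (?N - k) * (x $ j) ^ k * ?P x)"
    have "(\<Sum>k\<le>?N. (of_nat (?N choose k) * ?q k) * t ^ k) = 0" for t
    proof -
      have "((c + t *\<^sub>R axis j 1) \<bullet> x) ^ ?N * ?P x =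
            (\<Sum>k\<le>?N. (of_nat (?N choose k) * t ^ k) * ((c \<bullet> x) ^ (?N - k) * (x $ j) ^ k * ?P x))" for x
      proof -
        have "(c + t *\<^sub>R axis j 1) \<bullet> x = t * x $ j + c \<bullet> x"
          by (simp add: inner_add_left inner_axis' )
        then have "((c + t *\<^sub>R axis j 1) \<bullet> x) ^ ?N
            = (\<Sum>k\<le>?N. of_nat (?N choose k) * (t * x $ j) ^ k * (c \<bullet> x) ^ (?N - k))"
          by (simp only: binomial_ring)
        then show ?thesis
          by (simp only: sum_distrib_right power_mult_distrib) (simp add: mult_ac)
      qed
      then have "0 = Q (\<lambda>x. \<Sum>k\<le>?N. (of_nat (?N choose k) * t ^ k) *
                         ((c \<bullet> x) ^ (?N - k) * (x $ j) ^ k * ?P x))"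
        using insert.IH[of "c + t *\<^sub>R axis j 1"] by simp
      also have "\<dots> = (\<Sum>k\<le>?N. (of_nat (?N choose k) * t ^ k) * ?q k)"
        by (rule cubature_formula_linear[OF Q])
      finally show ?thesis by (simp add: mult_ac)
    qed
    from zero_polynom_imp_zero_coeffs[OF this le] have "?q (\<alpha> j) = 0"
      using le by simp
    then show ?case using insert.hyps by (simp add: eq ac_simps)
  qed
  from this[of UNIV 0] show ?thesis
    unfolding monomial_def[abs_def] total_degree_def by simp
qed

text \<open>Polarization applied to the difference \<open>Q (f \<circ> T) - Q f\<close> for a self-adjoint \<open>T\<close>.\<close>

lemma invariant_on_monomials:
  fixes Q :: "(real ^ 'd::finite \<Rightarrow> real) \<Rightarrow> real"
  assumes Q: "cubature_formula UNIV n Q"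
    and T: "\<And>c x. c \<bullet> T x = T c \<bullet> x"
    and inv: "\<And>c. Q (\<lambda>x. (T c \<bullet> x) ^ total_degree \<alpha>) = Q (\<lambda>x. (c \<bullet> x) ^ total_degree \<alpha>)"
  shows "Q (\<lambda>x. monomial \<alpha> (T x)) = Q (monomial \<alpha>)"
proof -
  define R where "R = (\<lambda>f. Q (\<lambda>x. f (T x)) + (-1) * Q f)"
  have "cubature_formula UNIV (n + n) R"
    unfolding R_def
    by (intro cubature_formula_add cubature_formula_scale cubature_formula_comp[OF Q] Q) auto
  then have "R (monomial \<alpha>) = 0"
    by (rule annihilates_powers_imp_annihilates_monomials) (simp add: R_def T inv)
  then show ?thesis by (simp add: R_def)
qed

definition flip :: "'d \<Rightarrow> real ^ 'd \<Rightarrow> real ^ 'd"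
  where "flip i x = (\<chi> j. if j = i then - x $ j else x $ j)"

definition swap_coords :: "'d \<Rightarrow> 'd \<Rightarrow> real ^ 'd \<Rightarrow> real ^ 'd"
  where "swap_coords i j x = (\<chi> k. x $ Transposition.transpose i j k)"

lemma inner_flip: "c \<bullet> flip i x = flip i c \<bullet> (x :: real ^ 'd::finite)"
  unfolding inner_vec_def flip_def by (rule sum.cong) auto

lemma inner_swap_coords: "c \<bullet> swap_coords i j x = swap_coords i j c \<bullet> (x :: real ^ 'd::finite)"
  unfolding inner_vec_def swap_coords_def
  by (rule sum.reindex_bij_witness[of _ "Transposition.transpose i j" "Transposition.transpose i j"]) auto

lemma monomial_flip:
  "monomial \<alpha> (flip i x) = (-1) ^ \<alpha> i * monomial \<alpha> (x :: real ^ 'd::finite)"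
proof -
  have "monomial \<alpha> (flip i x) = (\<Prod>j\<in>UNIV. (if j = i then (-1) ^ \<alpha> i else 1) * (x $ j) ^ \<alpha> j)"
    unfolding monomial_def flip_def
    by (rule prod.cong) (auto simp: power_mult_distrib[symmetric])
  then show ?thesis by (simp add: monomial_def prod.distrib)
qed

lemma monomial_swap_coords:
  "monomial \<alpha> (swap_coords i j x) = monomial (\<alpha> \<circ> Transposition.transpose i j) (x :: real ^ 'd::finite)"
  unfolding monomial_def swap_coords_def
  by (rule prod.reindex_bij_witness[of _ "Transposition.transpose i j" "Transposition.transpose i j"]) auto

section \<open>Power sums\<close>

definition power_sum :: "nat \<Rightarrow> real ^ 'd::finite \<Rightarrow> real"
  where "power_sum k c = (\<Sum>j\<in>UNIV. (c $ j) ^ k)"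

lemma power_sum_flip: "even k \<Longrightarrow> power_sum k (flip i c) = power_sum k c"
  unfolding power_sum_def flip_def by (rule sum.cong) auto

lemma power_sum_swap_coords: "power_sum k (swap_coords i j c) = power_sum k c"
  unfolding power_sum_def swap_coords_def
  by (rule sum.reindex_bij_witness[of _ "Transposition.transpose i j" "Transposition.transpose i j"]) auto

section \<open>Sums over pairs and triples\<close>

text \<open>The sum of \<open>f\<close> over the subset sums of size \<open>r\<close>, generalized from the full index set so that induction on \<open>A\<close> applies.\<close>

definition subset_sum :: "nat \<Rightarrow> 'd set \<Rightarrow> ('d \<Rightarrow> real) \<Rightarrow> (real \<Rightarrow> real) \<Rightarrow> real"
  where "subset_sum r A c f = (\<Sum>S | S \<subseteq> A \<and> card S = r. f (sum c S))"

lemma subset_sum_insert: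
  assumes "finite A" "x \<notin> A"
  shows "subset_sum (Suc r) (insert x A) c f
    = subset_sum (Suc r) A c f + subset_sum r A c (\<lambda>s. f (c x + s))"
proof -
  define F where "F k = {S. S \<subseteq> A \<and> card S = k}" for k
  have fin: "finite S" "x \<notin> S" if "S \<in> F k" for S k
    using assms that unfolding F_def by (auto intro: finite_subset)
  have finF: "finite (F k)" for k using assms(1) by (simp add: F_def)
  have split: "{S. S \<subseteq> insert x A \<and> card S = Suc r} = F (Suc r) \<union> insert x ` F r"
  proof (intro set_eqI iffI)
    fix S assume S: "S \<in> {S. S \<subseteq> insert x A \<and> card S = Suc r}"
    show "S \<in> F (Suc r) \<union> insert x ` F r"
    proof (cases "x \<in> S")
      case True
      have "S - {x} \<in> F r" using S True by (auto simp: F_def)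
      moreover have "S = insert x (S - {x})" using True by blast
      ultimately show ?thesis by blast
    qed (use S in \<open>auto simp: F_def\<close>)
  next
    fix S assume "S \<in> F (Suc r) \<union> insert x ` F r"
    then consider "S \<in> F (Suc r)" | T where "S = insert x T" "T \<in> F r" by blast
    then show "S \<in> {S. S \<subseteq> insert x A \<and> card S = Suc r}"
    proof cases
      case 2
      with fin[of T r] show ?thesis by (auto simp: F_def)
    qed (auto simp: F_def)
  qed
  have disj: "F (Suc r) \<inter> insert x ` F r = {}" using fin(2) by blast
  have inj: "inj_on (insert x) (F r)"
  proof (rule inj_onI)
    fix S T assume "S \<in> F r" "T \<in> F r" "insert x S = insert x T"
    then show "S = T" using insert_ident[OF fin(2)[of S r] fin(2)[of T r]] by simp
  qed
  have "subset_sum (Suc r) (insert x A) c f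
      = (\<Sum>S\<in>F (Suc r). f (sum c S)) + (\<Sum>S\<in>F r. f (sum c (insert x S)))"
    unfolding subset_sum_def split
    using finF disj by (subst sum.union_disjoint) (auto simp: sum.reindex[OF inj])
  also have "(\<Sum>S\<in>F r. f (sum c (insert x S))) = (\<Sum>S\<in>F r. f (c x + sum c S))"
    by (intro sum.cong refl) (use fin in \<open>metis sum.insert\<close>)
  finally show ?thesis by (simp add: subset_sum_def F_def)
qed

lemma subset_sum_empty_Suc: "subset_sum (Suc r) {} c f = 0"
proof -
  have "{S. S \<subseteq> {} \<and> card S = Suc r} = {}" by auto
  then show ?thesis unfolding subset_sum_def by (metis sum.empty)
qed

lemma subset_sum_0: "finite A \<Longrightarrow> subset_sum 0 A c f = f 0"
proof -
  assume "finite A"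
  then have "{S. S \<subseteq> A \<and> card S = 0} = {{}}" by (auto dest: finite_subset)
  then show ?thesis by (simp add: subset_sum_def)
qed

lemma subset_sum_1:
  assumes "finite A" shows "subset_sum 1 A c f = (\<Sum>i\<in>A. f (c i))"
  using assms
proof (induction A rule: finite_induct)
  case (insert x A)
  then show ?case using subset_sum_insert[of A x 0 c f] by (simp add: subset_sum_0)
qed (simp add: subset_sum_empty_Suc)

text \<open>Inclusion-exclusion over coinciding indices; the unrestricted sums are the ones that expand into power sums.\<close>

lemma subset_sum_2:
  assumes "finite A"
  shows "2 * subset_sum 2 A c f = (\<Sum>i\<in>A. \<Sum>j\<in>A. f (c i + c j)) - (\<Sum>i\<in>A. f (2 * c i))"
  using assms
proof (induction A rule: finite_induct)
  case empty
  then show ?case using subset_sum_empty_Suc[of 1 c f] by (simp add: numeral_2_eq_2)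
next
  case (insert x A)
  define U where "U = (\<Sum>i\<in>A. f (c x + c i))"
  have e1: "subset_sum 2 (insert x A) c f = subset_sum 2 A c f + U"
    using subset_sum_insert[of A x 1 c f] subset_sum_1[of A c] insert by (simp add: numeral_2_eq_2 U_def)
  have "(\<Sum>i\<in>A. f (c i + c x)) = U"
    unfolding U_def by (intro sum.cong refl arg_cong[of _ _ f], simp)
  then have e2: "(\<Sum>i\<in>insert x A. \<Sum>j\<in>insert x A. f (c i + c j))
      = (\<Sum>i\<in>A. \<Sum>j\<in>A. f (c i + c j)) + 2 * U + f (c x + c x)"
    unfolding sum.insert[OF insert(1,2)] sum.distrib U_def by linarith
  have e3: "(\<Sum>i\<in>insert x A. f (2 * c i)) = (\<Sum>i\<in>A. f (2 * c i)) + f (c x + c x)"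
    using insert(1,2) by simp
  show ?case using insert.IH unfolding e1 e2 e3 by argo
qed

lemma subset_sum_3:
  assumes "finite A"
  shows "6 * subset_sum 3 A c f = (\<Sum>i\<in>A. \<Sum>j\<in>A. \<Sum>k\<in>A. f (c i + c j + c k))
      - 3 * (\<Sum>i\<in>A. \<Sum>j\<in>A. f (2 * c i + c j)) + 2 * (\<Sum>i\<in>A. f (3 * c i))"
  using assms
proof (induction A rule: finite_induct)
  case empty
  then show ?case using subset_sum_empty_Suc[of 2 c f] by (simp add: numeral_3_eq_3 numeral_2_eq_2)
next
  case (insert x A)
  have "subset_sum 3 (insert x A) c f = subset_sum 3 A c f + subset_sum 2 A c (\<lambda>s. f (c x + s))"
    using subset_sum_insert[of A x 2 c f] insert by (simp add: numeral_3_eq_3 numeral_2_eq_2)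
  moreover define U where "U = (\<Sum>i\<in>A. \<Sum>j\<in>A. f (c x + (c i + c j)))"
  moreover define V where "V = (\<Sum>i\<in>A. f (2 * c x + c i))"
  moreover define W where "W = (\<Sum>i\<in>A. f (c x + 2 * c i))"
  ultimately have e1: "6 * subset_sum 3 (insert x A) c f = 6 * subset_sum 3 A c f + 3 * (U - W)"
    using subset_sum_2[of A c "\<lambda>s. f (c x + s)"] insert(1) by simp
  have e2: "(\<Sum>i\<in>insert x A. \<Sum>j\<in>insert x A. \<Sum>k\<in>insert x A. f (c i + c j + c k))
      = (\<Sum>i\<in>A. \<Sum>j\<in>A. \<Sum>k\<in>A. f (c i + c j + c k)) + 3 * U + 3 * V + f (3 * c x)"
  proof -
    have "(\<Sum>i\<in>A. \<Sum>j\<in>A. f (c x + c i + c j)) = U" "(\<Sum>i\<in>A. \<Sum>j\<in>A. f (c i + c x + c j)) = U"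
      "(\<Sum>i\<in>A. \<Sum>j\<in>A. f (c i + c j + c x)) = U"
      unfolding U_def by (intro sum.cong refl arg_cong[of _ _ f], simp)+
    moreover have "(\<Sum>i\<in>A. f (c x + c x + c i)) = V" "(\<Sum>i\<in>A. f (c x + c i + c x)) = V"
      "(\<Sum>i\<in>A. f (c i + c x + c x)) = V"
      unfolding V_def by (intro sum.cong refl arg_cong[of _ _ f], simp)+
    moreover have "f (c x + c x + c x) = f (3 * c x)" by (rule arg_cong[of _ _ f]) simp
    ultimately show ?thesis unfolding sum.insert[OF insert(1,2)] sum.distrib by linarith
  qed
  have e3: "(\<Sum>i\<in>insert x A. \<Sum>j\<in>insert x A. f (2 * c i + c j))
      = (\<Sum>i\<in>A. \<Sum>j\<in>A. f (2 * c i + c j)) + V + W + f (3 * c x)"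
  proof -
    have "(\<Sum>i\<in>A. f (2 * c i + c x)) = W"
      unfolding W_def by (intro sum.cong refl arg_cong[of _ _ f], simp)
    moreover have "f (2 * c x + c x) = f (3 * c x)" by (rule arg_cong[of _ _ f]) simp
    ultimately show ?thesis unfolding sum.insert[OF insert(1,2)] sum.distrib V_def by linarith
  qed
  have e4: "(\<Sum>i\<in>insert x A. f (3 * c i)) = (\<Sum>i\<in>A. f (3 * c i)) + f (3 * c x)"
    using insert(1,2) by simp
  have arith: "s' = T' - 3 * P' + 2 * G'"
    if "s' = s + 3 * (U - W)" "T' = T + 3 * U + 3 * V + F" "P' = P + V + W + F"
      "G' = G + F" "s = T - 3 * P + 2 * G" for s s' T T' P P' G G' F :: real
    using that by argo
  show ?case by (rule arith[OF e1 e2 e3 e4 insert.IH])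
qed

section \<open>Antipodal orbits\<close>

definition antipodal :: "real ^ 'd \<Rightarrow> (real ^ 'd \<Rightarrow> real) \<Rightarrow> real"
  where "antipodal y f = f y + f (- y)"

text \<open>All vectors \<open>b * (1, ..., 1) + a * (\<Sum>i\<in>S. e\<^sub>i)\<close> with \<open>card S = r\<close>, together with their antipodes: apart from
  antipodes, an orbit of the symmetric group acting on the coordinates.\<close>

definition subset_orbit :: "nat \<Rightarrow> real \<Rightarrow> real \<Rightarrow> (real ^ 'd::finite \<Rightarrow> real) \<Rightarrow> real"
  where "subset_orbit r a b f = (\<Sum>S | card S = r. antipodal (\<chi> j. b + a * of_bool (j \<in> S)) f)"

lemma cubature_formula_antipodal:
  assumes "y \<in> D" "- y \<in> D"
  shows "cubature_formula D 2 (antipodal y)"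
  unfolding antipodal_def[abs_def]
  using cubature_formula_add[OF assms[THEN cubature_formula_point]] by (simp add: numeral_2_eq_2)

lemma cubature_formula_subset_orbit:
  "cubature_formula UNIV ((CARD('d) choose r) * 2) (subset_orbit r a b :: (real ^ 'd::finite \<Rightarrow> real) \<Rightarrow> real)"
proof -
  have "cubature_formula UNIV (card {S :: 'd set. card S = r} * 2)
      (subset_orbit r a b :: (real ^ 'd \<Rightarrow> real) \<Rightarrow> real)"
    unfolding subset_orbit_def[abs_def]
    by (intro cubature_formula_sum cubature_formula_antipodal) auto
  then show ?thesis
    using n_subsets[of "UNIV :: 'd set" r] by simp
qed

lemma antipodal_even_power: "even m \<Longrightarrow> antipodal y (\<lambda>x. (c \<bullet> x) ^ m) = 2 * (c \<bullet> y) ^ m"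
  by (simp add: antipodal_def)

lemma antipodal_odd_power: "odd m \<Longrightarrow> antipodal y (\<lambda>x. (c \<bullet> x) ^ m) = 0"
  by (simp add: antipodal_def)

lemma subset_orbit_power:
  fixes c :: "real ^ 'd::finite"
  assumes "even m"
  shows "subset_orbit r a b (\<lambda>x. (c \<bullet> x) ^ m)
    = 2 * subset_sum r UNIV (\<lambda>j. c $ j) (\<lambda>s. (b * power_sum 1 c + a * s) ^ m)"
proof -
  have "c \<bullet> (\<chi> j. b + a * of_bool (j \<in> S)) = b * power_sum 1 c + a * (\<Sum>j\<in>S. c $ j)" for S
  proof -
    have "c \<bullet> (\<chi> j. b + a * of_bool (j \<in> S)) = (\<Sum>j\<in>UNIV. b * c $ j) + (\<Sum>j\<in>UNIV. if j \<in> S then a * c $ j else 0)"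
      unfolding inner_vec_def by (simp add: sum.distrib[symmetric] algebra_simps of_bool_def if_distrib cong: if_cong)
    also have "(\<Sum>j\<in>UNIV. if j \<in> S then a * c $ j else 0) = (\<Sum>j\<in>S. a * c $ j)"
      by (subst sum.inter_restrict[symmetric]) auto
    finally show ?thesis by (simp add: power_sum_def sum_distrib_left)
  qed
  then show ?thesis
    by (simp add: subset_orbit_def antipodal_even_power[OF assms] subset_sum_def sum_distrib_left
        del: vec_lambda_beta)
qed

lemma subset_orbit_odd_power:
  "odd m \<Longrightarrow> subset_orbit r a b (\<lambda>x. (c \<bullet> x) ^ m) = 0"
  by (simp add: subset_orbit_def antipodal_odd_power)

section \<open>Expansion of orbit sums in power sums\<close>

text \<open>The \<open>k\<close>-th power sum of the family of all sums \<open>c\<^sub>i + c\<^sub>j\<close>, in binomially expanded form.\<close>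

definition pair_power_sum :: "nat \<Rightarrow> real ^ 'd::finite \<Rightarrow> real"
  where "pair_power_sum k c = (\<Sum>l\<le>k. of_nat (k choose l) * power_sum l c * power_sum (k - l) c)"

lemma sum_shifted_power:
  fixes c :: "real ^ 'd::finite"
  shows "(\<Sum>i\<in>UNIV. (u + a * c $ i) ^ m) = (\<Sum>k\<le>m. of_nat (m choose k) * u ^ (m - k) * a ^ k * power_sum k c)"
proof -
  have "(u + a * c $ i) ^ m = (\<Sum>k\<le>m. of_nat (m choose k) * u ^ (m - k) * a ^ k * (c $ i) ^ k)" for i
    using binomial_ring[of "a * c $ i" u m] by (simp add: power_mult_distrib mult_ac add.commute)
  then show ?thesis
    unfolding power_sum_def sum_distrib_left by simp (rule sum.swap)
qed

lemma sum_pair_power: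
  fixes c :: "real ^ 'd::finite"
  shows "(\<Sum>i\<in>UNIV. \<Sum>j\<in>UNIV. (c $ i + c $ j) ^ m) = pair_power_sum m c"
proof -
  have "(\<Sum>i\<in>UNIV. \<Sum>j\<in>UNIV. (c $ i + c $ j) ^ m)
      = (\<Sum>i\<in>UNIV. \<Sum>k\<le>m. of_nat (m choose k) * (c $ i) ^ (m - k) * power_sum k c)"
    using sum_shifted_power[of _ 1 c m] by simp
  also have "\<dots> = (\<Sum>k\<le>m. of_nat (m choose k) * power_sum (m - k) c * power_sum k c)"
    by (subst sum.swap) (simp only: sum_distrib_left[symmetric] sum_distrib_right[symmetric] power_sum_def)
  finally show ?thesis by (simp add: pair_power_sum_def mult_ac)
qed

lemma sum_shifted_pair_power:
  fixes c :: "real ^ 'd::finite"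
  shows "(\<Sum>i\<in>UNIV. \<Sum>j\<in>UNIV. (u + (c $ i + c $ j)) ^ m)
    = (\<Sum>k\<le>m. of_nat (m choose k) * u ^ (m - k) * pair_power_sum k c)"
proof -
  have "(u + (c $ i + c $ j)) ^ m = (\<Sum>k\<le>m. of_nat (m choose k) * u ^ (m - k) * (c $ i + c $ j) ^ k)" for i j
    using binomial_ring[of "c $ i + c $ j" u m] by (simp add: mult_ac add.commute)
  then have "(\<Sum>i\<in>UNIV. \<Sum>j\<in>UNIV. (u + (c $ i + c $ j)) ^ m)
      = (\<Sum>i\<in>UNIV. \<Sum>k\<le>m. \<Sum>j\<in>UNIV. of_nat (m choose k) * u ^ (m - k) * (c $ i + c $ j) ^ k)"
    by simp (subst sum.swap, rule refl)
  also have "\<dots> = (\<Sum>k\<le>m. \<Sum>i\<in>UNIV. \<Sum>j\<in>UNIV. of_nat (m choose k) * u ^ (m - k) * (c $ i + c $ j) ^ k)"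
    by (rule sum.swap)
  finally show ?thesis
    by (simp only: sum_distrib_left[symmetric] sum_pair_power)
qed

lemma sum_triple_power:
  fixes c :: "real ^ 'd::finite"
  shows "(\<Sum>i\<in>UNIV. \<Sum>j\<in>UNIV. \<Sum>k\<in>UNIV. (c $ i + c $ j + c $ k) ^ m)
    = (\<Sum>k\<le>m. of_nat (m choose k) * power_sum (m - k) c * pair_power_sum k c)"
proof -
  have "(\<Sum>i\<in>UNIV. \<Sum>j\<in>UNIV. \<Sum>k\<in>UNIV. (c $ i + c $ j + c $ k) ^ m)
      = (\<Sum>i\<in>UNIV. \<Sum>k\<le>m. of_nat (m choose k) * (c $ i) ^ (m - k) * pair_power_sum k c)"
    by (simp only: add.assoc sum_shifted_pair_power)
  also have "\<dots> = (\<Sum>k\<le>m. \<Sum>i\<in>UNIV. of_nat (m choose k) * (c $ i) ^ (m - k) * pair_power_sum k c)"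
    by (rule sum.swap)
  finally show ?thesis
    by (simp only: sum_distrib_left[symmetric] sum_distrib_right[symmetric] power_sum_def)
qed

lemma point_orbit_power:
  fixes c :: "real ^ 'd::finite"
  assumes "even m"
  shows "subset_orbit 1 a b (\<lambda>x. (c \<bullet> x) ^ m)
    = 2 * (\<Sum>k\<le>m. of_nat (m choose k) * (b * power_sum 1 c) ^ (m - k) * a ^ k * power_sum k c)"
  using subset_orbit_power[OF assms, of 1 a b c] by (simp add: subset_sum_1 sum_shifted_power del: One_nat_def)

lemma pair_orbit_power:
  fixes c :: "real ^ 'd::finite"
  assumes "even m"
  shows "subset_orbit 2 1 b (\<lambda>x. (c \<bullet> x) ^ m)
    = (\<Sum>k\<le>m. of_nat (m choose k) * (b * power_sum 1 c) ^ (m - k) * pair_power_sum k c)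
    - (\<Sum>k\<le>m. of_nat (m choose k) * (b * power_sum 1 c) ^ (m - k) * 2 ^ k * power_sum k c)"
  unfolding subset_orbit_power[OF assms] subset_sum_2[OF finite]
  by (simp add: sum_shifted_power sum_shifted_pair_power)

text \<open>The factor 3 clears the denominator: each orbit point and its antipode contribute equally, and each triple of distinct
  indices is counted 6 times.\<close>

lemma triple_orbit_power:
  fixes c :: "real ^ 'd::finite"
  assumes "even m"
  shows "3 * subset_orbit 3 1 0 (\<lambda>x. (c \<bullet> x) ^ m)
    = (\<Sum>k\<le>m. of_nat (m choose k) * power_sum (m - k) c * pair_power_sum k c)
    - 3 * (\<Sum>k\<le>m. of_nat (m choose k) * 2 ^ (m - k) * power_sum (m - k) c * power_sum k c)
    + 2 * 3 ^ m * power_sum m c"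
proof -
  have "(\<Sum>i\<in>UNIV. \<Sum>j\<in>UNIV. (2 * c $ i + c $ j) ^ m)
      = (\<Sum>i\<in>UNIV. \<Sum>k\<le>m. of_nat (m choose k) * 2 ^ (m - k) * (c $ i) ^ (m - k) * power_sum k c)"
    using sum_shifted_power[of _ 1 c m] by (simp add: power_mult_distrib mult_ac)
  also have "\<dots> = (\<Sum>k\<le>m. \<Sum>i\<in>UNIV. of_nat (m choose k) * 2 ^ (m - k) * (c $ i) ^ (m - k) * power_sum k c)"
    by (rule sum.swap)
  also have "\<dots> = (\<Sum>k\<le>m. of_nat (m choose k) * 2 ^ (m - k) * power_sum (m - k) c * power_sum k c)"
    by (simp only: sum_distrib_left[symmetric] sum_distrib_right[symmetric] power_sum_def)
  finally have 2: "(\<Sum>i\<in>UNIV. \<Sum>j\<in>UNIV. (2 * c $ i + c $ j) ^ m) = \<dots>" .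
  have 3: "(\<Sum>i\<in>UNIV. (3 * c $ i) ^ m) = 3 ^ m * power_sum m c"
    by (simp only: power_mult_distrib power_sum_def sum_distrib_left)
  show ?thesis
    using subset_orbit_power[OF assms, of 3 1 0 c]
      subset_sum_3[OF finite, of UNIV "\<lambda>j. c $ j" "\<lambda>s. s ^ m"]
    by (simp add: sum_triple_power 2 3[unfolded power_mult_distrib])
qed

lemma power_sum_0: "power_sum 0 (c :: real ^ 'd::finite) = real CARD('d)"
  by (simp add: power_sum_def)

lemma atMost_explicit:
  "{..0::nat} = {0}" "{..1::nat} = {0,1}" "{..2::nat} = {0,1,2}" "{..3::nat} = {0,1,2,3}" "{..4::nat} = {0,1,2,3,4}"
  "{..5::nat} = {0,1,2,3,4,5}" "{..6::nat} = {0,1,2,3,4,5,6}"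
  by auto

lemma binomial_explicit:
  "(2 choose 1 :: nat) = 2"
  "(3 choose 1 :: nat) = 3" "(3 choose 2 :: nat) = 3"
  "(4 choose 1 :: nat) = 4" "(4 choose 2 :: nat) = 6" "(4 choose 3 :: nat) = 4"
  "(5 choose 1 :: nat) = 5" "(5 choose 2 :: nat) = 10" "(5 choose 3 :: nat) = 10" "(5 choose 4 :: nat) = 5"
  "(6 choose 1 :: nat) = 6" "(6 choose 2 :: nat) = 15" "(6 choose 3 :: nat) = 20" "(6 choose 4 :: nat) = 15"
  "(6 choose 5 :: nat) = 6"
  by (simp_all add: eval_nat_numeral)

lemma pair_power_sum_explicit:
  fixes c :: "real ^ 'd::finite"
  shows "pair_power_sum 0 c = real CARD('d) ^ 2"
    "pair_power_sum 1 c = 2 * real CARD('d) * power_sum 1 c"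
    "pair_power_sum 2 c = 2 * real CARD('d) * power_sum 2 c + 2 * power_sum 1 c ^ 2"
    "pair_power_sum 3 c = 2 * real CARD('d) * power_sum 3 c + 6 * power_sum 1 c * power_sum 2 c"
    "pair_power_sum 4 c = 2 * real CARD('d) * power_sum 4 c + 8 * power_sum 1 c * power_sum 3 c
        + 6 * power_sum 2 c ^ 2"
    "pair_power_sum 5 c = 2 * real CARD('d) * power_sum 5 c + 10 * power_sum 1 c * power_sum 4 c
        + 20 * power_sum 2 c * power_sum 3 c"
    "pair_power_sum 6 c = 2 * real CARD('d) * power_sum 6 c + 12 * power_sum 1 c * power_sum 5 c
        + 30 * power_sum 2 c * power_sum 4 c + 20 * power_sum 3 c ^ 2"
  unfolding pair_power_sum_def atMost_explicit
  by (simp_all add: binomial_explicit power_sum_0 power2_eq_square)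

lemmas orbit_power_simps =
  atMost_explicit binomial_explicit pair_power_sum_explicit power_sum_0
  arg_cong[OF One_nat_def[symmetric], of "\<lambda>k. power_sum k c" for c]
  arg_cong[OF One_nat_def[symmetric], of "\<lambda>k. pair_power_sum k c" for c]

section \<open>Cancelling the multiples of the first power sum\<close>

text \<open>The squares of the nodes 1, 2, 3 are distinct. The weights below are Lagrange coefficients at these squares.\<close>

lemma vandermonde_1_4_9:
  fixes x y z :: real
  obtains u v w where "u + 4 * v + 9 * w = z" "u + 16 * v + 81 * w = y" "u + 64 * v + 729 * w = x"
proof
  \<comment> \<open>The numerators come from \<open>(t - 4) (t - 9)\<close>, \<open>(t - 1) (t - 9)\<close>, \<open>(t - 1) (t - 4)\<close>.\<close>
  let ?u = "(x - 13 * y + 36 * z) / 24" and ?v = "(x - 10 * y + 9 * z) / (-60)"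
    and ?w = "(x - 5 * y + 4 * z) / 360"
  show "?u + 4 * ?v + 9 * ?w = z" "?u + 16 * ?v + 81 * ?w = y" "?u + 64 * ?v + 729 * ?w = x"
    by (simp_all add: field_simps)
qed

text \<open>Any prescribed multiples of \<open>p\<^sub>1\<close> of the listed types can be produced, up to terms \<open>p\<^sub>6\<close>, \<open>p\<^sub>4\<close>, \<open>p\<^sub>2\<close>, with a number of
  knots linear in the dimension. The orbit of \<open>b * (1, ..., 1) + a * e\<^sub>i\<close> contributes \<open>a ^ i * b ^ j\<close> to
  \<open>p\<^sub>1 ^ j * p\<^sub>i\<close> (up to a binomial coefficient), so six terms have to be matched:
  \<open>a\<^sup>5 b\<close>, \<open>a\<^sup>3 b\<^sup>3\<close>, \<open>a\<^sup>3 b\<close>, odd in \<open>b\<close>, and \<open>a\<^sup>4 b\<^sup>2\<close>, \<open>a\<^sup>2 b\<^sup>4\<close>, \<open>a\<^sup>2 b\<^sup>2\<close>, even in \<open>b\<close>.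
  Pairing \<open>b\<close> with \<open>-b\<close> separates the two groups, and on the points \<open>(1, 1)\<close>, \<open>(2, 1)\<close>, \<open>(1, 2)\<close> both 3 by 3 systems
  are regular. The remaining pure powers of \<open>p\<^sub>1\<close> come from multiples of \<open>(1, ..., 1)\<close>.\<close>

lemma cancel_power_sum_1_multiples:
  fixes x0 x2 x3 x4 x5 y0 y2 y3 z :: real
  obtains Q :: "(real ^ 'd::finite \<Rightarrow> real) \<Rightarrow> real" and A B C :: real
  where "cubature_formula UNIV (12 * CARD('d) + 6) Q"
    and "\<And>c m. odd m \<Longrightarrow> Q (\<lambda>x. (c \<bullet> x) ^ m) = 0"
    and "\<And>c. Q (\<lambda>x. (c \<bullet> x) ^ 6) = x5 * power_sum 1 c * power_sum 5 c
        + x4 * power_sum 1 c ^ 2 * power_sum 4 c + x3 * power_sum 1 c ^ 3 * power_sum 3 c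
        + x2 * power_sum 1 c ^ 4 * power_sum 2 c + x0 * power_sum 1 c ^ 6 + A * power_sum 6 c"
    and "\<And>c. Q (\<lambda>x. (c \<bullet> x) ^ 4) = y3 * power_sum 1 c * power_sum 3 c
        + y2 * power_sum 1 c ^ 2 * power_sum 2 c + y0 * power_sum 1 c ^ 4 + B * power_sum 4 c"
    and "\<And>c. Q (\<lambda>x. (c \<bullet> x) ^ 2) = z * power_sum 1 c ^ 2 + C * power_sum 2 c"
proof -
  define d where "d = real CARD('d)"
  \<comment> \<open>\<open>o\<close> and \<open>e\<close>: differences and sums of the weights at shifts \<open>b\<close> and \<open>-b\<close>, for the three points \<open>(1, 1)\<close>, \<open>(2, 1)\<close>, \<open>(1, 2)\<close>.\<close>
  define o2 where "o2 = (x5 / 6 - y3 / 4) / 24"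
  define o3 where "o3 = (x3 / 20 - y3 / 4) / 6"
  define o1 where "o1 = y3 / 4 - 8 * o2 - 2 * o3"
  define e2 where "e2 = (x4 / 15 - y2 / 6) / 12"
  define e3 where "e3 = (x2 / 15 - y2 / 6) / 12"
  define e1 where "e1 = y2 / 6 - 4 * e2 - 4 * e3"
  \<comment> \<open>Besides the prescribed multiples, the pure powers of \<open>p\<^sub>1\<close> created by the six orbits have to be compensated.\<close>
  obtain u v w where uvw:
    "u + 4 * v + 9 * w = z - (2 * (o1 + 2 * o2 + 2 * o3) + d * (e1 + e2 + 4 * e3))"
    "u + 16 * v + 81 * w = y0 - (4 * (o1 + 2 * o2 + 8 * o3) + d * (e1 + e2 + 16 * e3))"
    "u + 64 * v + 729 * w = x0 - (6 * (o1 + 2 * o2 + 32 * o3) + d * (e1 + e2 + 64 * e3))"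
    by (rule vandermonde_1_4_9)
  let ?p = "\<lambda>s :: real. antipodal (\<chi> j :: 'd. s)"
  define Q :: "(real ^ 'd::finite \<Rightarrow> real) \<Rightarrow> real" where
    "Q f = (e1 + o1) / 4 * subset_orbit 1 1 1 f + (e1 - o1) / 4 * subset_orbit 1 1 (-1) f
      + (e2 + o2) / 4 * subset_orbit 1 2 1 f + (e2 - o2) / 4 * subset_orbit 1 2 (-1) f
      + (e3 + o3) / 4 * subset_orbit 1 1 2 f + (e3 - o3) / 4 * subset_orbit 1 1 (-2) f
      + u / 2 * ?p 1 f + v / 2 * ?p 2 f + w / 2 * ?p 3 f" for f
  have knots: "cubature_formula UNIV ((CARD('d) choose 1) * 2 + (CARD('d) choose 1) * 2
      + (CARD('d) choose 1) * 2 + (CARD('d) choose 1) * 2 + (CARD('d) choose 1) * 2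
      + (CARD('d) choose 1) * 2 + 2 + 2 + 2) Q"
    unfolding Q_def
    by (intro cubature_formula_add cubature_formula_scale cubature_formula_subset_orbit
        cubature_formula_antipodal UNIV_I)
  have p: "?p s (\<lambda>x. (c \<bullet> x) ^ m) = 2 * (s * power_sum 1 c) ^ m" if "even m" for s c m
  proof -
    have "c \<bullet> (\<chi> j. s) = s * power_sum 1 c"
      by (simp add: inner_vec_def power_sum_def sum_distrib_left mult.commute)
    then show ?thesis using that by (simp add: antipodal_even_power)
  qed
  note eqs = o1_def o2_def o3_def e1_def e2_def e3_def
  show thesis
  proof
    show "cubature_formula UNIV (12 * CARD('d) + 6) Q"
      using knots by (rule back_subst[of "\<lambda>n. cubature_formula UNIV n Q"]) simp
    show "Q (\<lambda>x. (c \<bullet> x) ^ m) = 0" if "odd m" for c m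
      by (simp add: Q_def subset_orbit_odd_power antipodal_odd_power that)
    fix c :: "real ^ 'd"
    let ?q = "\<lambda>k. power_sum k c"
    have "Q (\<lambda>x. (c \<bullet> x) ^ 6) =
        6 * (o1 + 32 * o2 + 2 * o3) * ?q 1 * ?q 5 + 15 * (e1 + 16 * e2 + 4 * e3) * ?q 1 ^ 2 * ?q 4
        + 20 * (o1 + 8 * o2 + 8 * o3) * ?q 1 ^ 3 * ?q 3 + 15 * (e1 + 4 * e2 + 16 * e3) * ?q 1 ^ 4 * ?q 2
        + (6 * (o1 + 2 * o2 + 32 * o3) + d * (e1 + e2 + 64 * e3) + (u + 64 * v + 729 * w)) * ?q 1 ^ 6
        + (e1 + 64 * e2 + e3) * ?q 6"
      unfolding Q_def
      by (simp add: point_orbit_power p orbit_power_simps d_def[symmetric] power_mult_distrib del: One_nat_def) algebra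
    also have "\<dots> = x5 * ?q 1 * ?q 5 + x4 * ?q 1 ^ 2 * ?q 4 + x3 * ?q 1 ^ 3 * ?q 3
        + x2 * ?q 1 ^ 4 * ?q 2 + x0 * ?q 1 ^ 6 + (e1 + 64 * e2 + e3) * ?q 6"
    proof -
      have "6 * (o1 + 32 * o2 + 2 * o3) = x5" "15 * (e1 + 16 * e2 + 4 * e3) = x4"
        "20 * (o1 + 8 * o2 + 8 * o3) = x3" "15 * (e1 + 4 * e2 + 16 * e3) = x2"
        unfolding eqs by (simp_all add: field_simps)
      then show ?thesis using uvw(3) by simp
    qed
    finally show "Q (\<lambda>x. (c \<bullet> x) ^ 6) = \<dots>" .
    have "Q (\<lambda>x. (c \<bullet> x) ^ 4) =
        4 * (o1 + 8 * o2 + 2 * o3) * ?q 1 * ?q 3 + 6 * (e1 + 4 * e2 + 4 * e3) * ?q 1 ^ 2 * ?q 2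
        + (4 * (o1 + 2 * o2 + 8 * o3) + d * (e1 + e2 + 16 * e3) + (u + 16 * v + 81 * w)) * ?q 1 ^ 4
        + (e1 + 16 * e2 + e3) * ?q 4"
      unfolding Q_def
      by (simp add: point_orbit_power p orbit_power_simps d_def[symmetric] power_mult_distrib del: One_nat_def) algebra
    also have "\<dots> = y3 * ?q 1 * ?q 3 + y2 * ?q 1 ^ 2 * ?q 2 + y0 * ?q 1 ^ 4 + (e1 + 16 * e2 + e3) * ?q 4"
    proof -
      have "4 * (o1 + 8 * o2 + 2 * o3) = y3" "6 * (e1 + 4 * e2 + 4 * e3) = y2"
        unfolding eqs by (simp_all add: field_simps)
      then show ?thesis using uvw(2) by simp
    qed
    finally show "Q (\<lambda>x. (c \<bullet> x) ^ 4) = \<dots>" .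
    have "Q (\<lambda>x. (c \<bullet> x) ^ 2) =
        (2 * (o1 + 2 * o2 + 2 * o3) + d * (e1 + e2 + 4 * e3) + (u + 4 * v + 9 * w)) * ?q 1 ^ 2
        + (e1 + 4 * e2 + e3) * ?q 2"
      unfolding Q_def
      by (simp add: point_orbit_power p orbit_power_simps d_def[symmetric] power_mult_distrib del: One_nat_def) algebra
    also have "\<dots> = z * ?q 1 ^ 2 + (e1 + 4 * e2 + e3) * ?q 2"
      using uvw(1) by simp
    finally show "Q (\<lambda>x. (c \<bullet> x) ^ 2) = \<dots>" .
  qed
qed

section \<open>Designs whose power functions are even\<close>

text \<open>In degree 6 the orbit of triples contributes, besides \<open>90 p\<^sub>2\<^sup>3\<close>, the term \<open>360 p\<^sub>1 p\<^sub>2 p\<^sub>3\<close>, a multiple of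
  \<open>p\<^sub>3\<^sup>2\<close>, and further multiples of \<open>p\<^sub>1\<close>. The difference of the pair orbits with shifts \<open>b = 1\<close> and \<open>b = -1\<close> is odd in
  \<open>b\<close>, hence free of \<open>p\<^sub>1\<^sup>2 p\<^sub>2\<^sup>2\<close>, and cancels \<open>p\<^sub>1 p\<^sub>2 p\<^sub>3\<close>; the unshifted pair orbit then cancels \<open>p\<^sub>3\<^sup>2\<close>.
  All that remains is of the kind treated in \<open>cancel_power_sum_1_multiples\<close>.\<close>

lemma main_part_degree_7:
  obtains Q :: "(real ^ 'd::finite \<Rightarrow> real) \<Rightarrow> real" and A B C D E :: real
  where "cubature_formula UNIV ((CARD('d) choose 3) * 2 + (CARD('d) choose 2) * 6 + (12 * CARD('d) + 6)) Q"
    and "\<And>c m. odd m \<Longrightarrow> Q (\<lambda>x. (c \<bullet> x) ^ m) = 0"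
    and "\<And>c. Q (\<lambda>x. (c \<bullet> x) ^ 6) = 90 * power_sum 2 c ^ 3 + A * power_sum 2 c * power_sum 4 c
        + B * power_sum 6 c"
    and "\<And>c. Q (\<lambda>x. (c \<bullet> x) ^ 4) = C * power_sum 2 c ^ 2 + D * power_sum 4 c"
    and "\<And>c. Q (\<lambda>x. (c \<bullet> x) ^ 2) = E * power_sum 2 c"
proof -
  define d where "d = real CARD('d)"
  \<comment> \<open>The multiples of \<open>p\<^sub>3\<^sup>2\<close> are \<open>60 d - 480\<close> for the triples with weight 3 and 20 for the unshifted pairs.\<close>
  define M :: "(real ^ 'd::finite \<Rightarrow> real) \<Rightarrow> real" where
    "M f = 3 * subset_orbit 3 1 0 f + (- 3 / 2) * subset_orbit 2 1 1 f
      + (3 / 2) * subset_orbit 2 1 (-1) f + (24 - 3 * d) * subset_orbit 2 1 0 f" for f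
  have knots: "cubature_formula UNIV ((CARD('d) choose 3) * 2 + (CARD('d) choose 2) * 2
      + (CARD('d) choose 2) * 2 + (CARD('d) choose 2) * 2) M"
    unfolding M_def
    by (intro cubature_formula_add cubature_formula_scale cubature_formula_subset_orbit)
  note simps = point_orbit_power pair_orbit_power triple_orbit_power orbit_power_simps d_def[symmetric]
    power_mult_distrib
  have M6: "M (\<lambda>x. (c \<bullet> x) ^ 6) = 90 * power_sum 2 c ^ 3 - 180 * power_sum 2 c * power_sum 4 c
      + (45 * d - 3 * d ^ 2 - 78) * power_sum 6 c + (252 - 36 * d) * power_sum 1 c * power_sum 5 c
      - 90 * power_sum 1 c ^ 2 * power_sum 4 c + (480 - 120 * d) * power_sum 1 c ^ 3 * power_sum 3 c
      - 360 * power_sum 1 c ^ 4 * power_sum 2 c + (36 - 36 * d) * power_sum 1 c ^ 6" for c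
    unfolding M_def by (simp add: simps del: One_nat_def) algebra
  have M4: "M (\<lambda>x. (c \<bullet> x) ^ 4) = 72 * power_sum 2 c ^ 2 + (45 * d - 3 * d ^ 2 - 222) * power_sum 4 c
      + (168 - 24 * d) * power_sum 1 c * power_sum 3 c - 36 * power_sum 1 c ^ 2 * power_sum 2 c
      + (24 - 24 * d) * power_sum 1 c ^ 4" for c
    unfolding M_def by (simp add: simps del: One_nat_def) algebra
  have M2: "M (\<lambda>x. (c \<bullet> x) ^ 2) = (45 * d - 3 * d ^ 2 - 78) * power_sum 2 c
      + (48 - 12 * d) * power_sum 1 c ^ 2" for c
    unfolding M_def by (simp add: simps del: One_nat_def) algebra
  obtain R :: "(real ^ 'd \<Rightarrow> real) \<Rightarrow> real" and A B C where R:
    "cubature_formula UNIV (12 * CARD('d) + 6) R"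
    "\<And>c m. odd m \<Longrightarrow> R (\<lambda>x. (c \<bullet> x) ^ m) = 0"
    "\<And>c. R (\<lambda>x. (c \<bullet> x) ^ 6) = (36 * d - 252) * power_sum 1 c * power_sum 5 c
        + 90 * power_sum 1 c ^ 2 * power_sum 4 c + (120 * d - 480) * power_sum 1 c ^ 3 * power_sum 3 c
        + 360 * power_sum 1 c ^ 4 * power_sum 2 c + (36 * d - 36) * power_sum 1 c ^ 6 + A * power_sum 6 c"
    "\<And>c. R (\<lambda>x. (c \<bullet> x) ^ 4) = (24 * d - 168) * power_sum 1 c * power_sum 3 c
        + 36 * power_sum 1 c ^ 2 * power_sum 2 c + (24 * d - 24) * power_sum 1 c ^ 4 + B * power_sum 4 c"
    "\<And>c. R (\<lambda>x. (c \<bullet> x) ^ 2) = (12 * d - 48) * power_sum 1 c ^ 2 + C * power_sum 2 c"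
    by (rule cancel_power_sum_1_multiples[where ?'d = 'd and ?x5.0 = "36 * d - 252" and ?x4.0 = 90
          and ?x3.0 = "120 * d - 480" and ?x2.0 = 360 and ?x0.0 = "36 * d - 36" and ?y3.0 = "24 * d - 168"
          and ?y2.0 = 36 and ?y0.0 = "24 * d - 24" and z = "12 * d - 48"])
       (rule that; (assumption | simp del: One_nat_def))
  show thesis
  proof
    show "cubature_formula UNIV ((CARD('d) choose 3) * 2 + (CARD('d) choose 2) * 6 + (12 * CARD('d) + 6))
        (\<lambda>f. M f + R f)"
      using cubature_formula_add[OF knots R(1)]
      by (rule back_subst[of "\<lambda>n. cubature_formula UNIV n (\<lambda>f. M f + R f)"]) simp
    show "M (\<lambda>x. (c \<bullet> x) ^ m) + R (\<lambda>x. (c \<bullet> x) ^ m) = 0" if "odd m" for c m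
      by (simp add: M_def subset_orbit_odd_power R(2) that)
    show "M (\<lambda>x. (c \<bullet> x) ^ 6) + R (\<lambda>x. (c \<bullet> x) ^ 6) = 90 * power_sum 2 c ^ 3
        + (- 180) * power_sum 2 c * power_sum 4 c + (45 * d - 3 * d ^ 2 - 78 + A) * power_sum 6 c" for c
      unfolding M6 R(3) by algebra
    show "M (\<lambda>x. (c \<bullet> x) ^ 4) + R (\<lambda>x. (c \<bullet> x) ^ 4) = 72 * power_sum 2 c ^ 2
        + (45 * d - 3 * d ^ 2 - 222 + B) * power_sum 4 c" for c
      unfolding M4 R(4) by algebra
    show "M (\<lambda>x. (c \<bullet> x) ^ 2) + R (\<lambda>x. (c \<bullet> x) ^ 2) = (45 * d - 3 * d ^ 2 - 78 + C) * power_sum 2 c" for c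
      unfolding M2 R(5) by algebra
  qed
qed

text \<open>The pair orbit has power functions \<open>6 p\<^sub>2\<^sup>2 + 8 p\<^sub>1 p\<^sub>3\<close> and, with the scaling by \<open>1 / sqrt 2\<close>, \<open>4 p\<^sub>1\<^sup>2\<close>, up to
  \<open>p\<^sub>4\<close> and \<open>p\<^sub>2\<close>. Two orbits of points \<open>b * (1, ..., 1) + e\<^sub>i\<close> must cancel \<open>p\<^sub>1 p\<^sub>3\<close>, \<open>p\<^sub>1\<^sup>2 p\<^sub>2\<close>, \<open>p\<^sub>1\<^sup>4\<close> and
  \<open>p\<^sub>1\<^sup>2\<close> with only two weights. The second shift \<open>t\<close> solves \<open>4 + d * (1 + t) = 0\<close>, which makes the
  \<open>p\<^sub>1\<^sup>4\<close>-condition follow from the one for \<open>p\<^sub>1\<^sup>2 p\<^sub>2\<close>; the scale of the pair orbit takes care of \<open>p\<^sub>1\<^sup>2\<close>.\<close>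

lemma main_part_degree_5:
  obtains Q :: "(real ^ 'd::finite \<Rightarrow> real) \<Rightarrow> real" and A B :: real
  where "cubature_formula UNIV ((CARD('d) choose 2) * 2 + 4 * CARD('d)) Q"
    and "\<And>c m. odd m \<Longrightarrow> Q (\<lambda>x. (c \<bullet> x) ^ m) = 0"
    and "\<And>c. Q (\<lambda>x. (c \<bullet> x) ^ 4) = 6 * power_sum 2 c ^ 2 + A * power_sum 4 c"
    and "\<And>c. Q (\<lambda>x. (c \<bullet> x) ^ 2) = B * power_sum 2 c"
proof -
  define d where "d = real CARD('d)"
  have d: "d > 0" by (simp add: d_def)
  define t where "t = - (d + 4) / d"
  define u where "u = - (d + 4) / (d + 2)"
  define v where "v = d ^ 2 / ((d + 2) * (d + 4))"
  define Q :: "(real ^ 'd::finite \<Rightarrow> real) \<Rightarrow> real" where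
    "Q f = 4 * subset_orbit 2 (1 / sqrt 2) 0 f + u / 2 * subset_orbit 1 1 1 f
      + v / 2 * subset_orbit 1 1 t f" for f
  have knots: "cubature_formula UNIV ((CARD('d) choose 2) * 2 + (CARD('d) choose 1) * 2
      + (CARD('d) choose 1) * 2) Q"
    unfolding Q_def
    by (intro cubature_formula_add cubature_formula_scale cubature_formula_subset_orbit)
  have pair: "subset_orbit 2 a 0 (\<lambda>x. (c \<bullet> x) ^ m) = a ^ m * subset_orbit 2 1 0 (\<lambda>x. (c \<bullet> x) ^ m)"
    if "even m" for a m and c :: "real ^ 'd"
    unfolding subset_orbit_power[OF that]
    by (simp add: subset_sum_def power_mult_distrib sum_distrib_left mult.left_commute)
  have sqrt2: "(1 / sqrt 2) ^ 2 = (1 / 2 :: real)" "(1 / sqrt 2) ^ 4 = (1 / 4 :: real)"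
    using power_mult[of "sqrt 2" 2 2] by (simp_all add: power_one_over)
  note simps = point_orbit_power pair[of _ "1 / sqrt 2"] sqrt2 pair_orbit_power orbit_power_simps d_def[symmetric]
    power_mult_distrib
  show thesis
  proof
    show "cubature_formula UNIV ((CARD('d) choose 2) * 2 + 4 * CARD('d)) Q"
      using knots by (rule back_subst[of "\<lambda>n. cubature_formula UNIV n Q"]) simp
    show "Q (\<lambda>x. (c \<bullet> x) ^ m) = 0" if "odd m" for c m
      by (simp add: Q_def subset_orbit_odd_power that)
    fix c :: "real ^ 'd"
    let ?q = "\<lambda>k. power_sum k c"
    have "Q (\<lambda>x. (c \<bullet> x) ^ 4) = 6 * ?q 2 ^ 2 + (2 * d - 16 + u + v) * ?q 4
        + (8 + 4 * (u + v * t)) * ?q 1 * ?q 3 + 6 * (u + v * t ^ 2) * ?q 1 ^ 2 * ?q 2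
        + (4 * (u + v * t ^ 3) + d * (u + v * t ^ 4)) * ?q 1 ^ 4"
      unfolding Q_def by (simp add: simps del: One_nat_def) algebra
    also have "\<dots> = 6 * ?q 2 ^ 2 + (2 * d - 16 + u + v) * ?q 4"
    proof -
      have "8 + 4 * (u + v * t) = 0"
        using d unfolding u_def v_def t_def by (simp add: divide_simps) algebra
      moreover have "u + v * t ^ 2 = 0"
        using d unfolding u_def v_def t_def by (simp add: divide_simps) algebra
      moreover have "4 * (u + v * t ^ 3) + d * (u + v * t ^ 4) = 0"
        using d unfolding u_def v_def t_def by (simp add: divide_simps) algebra
      ultimately show ?thesis by simp
    qed
    finally show "Q (\<lambda>x. (c \<bullet> x) ^ 4) = \<dots>" .
    have "Q (\<lambda>x. (c \<bullet> x) ^ 2) = (4 * d - 8 + u + v) * ?q 2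
        + (4 + u * (2 + d) + v * (2 * t + d * t ^ 2)) * ?q 1 ^ 2"
      unfolding Q_def by (simp add: simps del: One_nat_def) algebra
    also have "\<dots> = (4 * d - 8 + u + v) * ?q 2"
    proof -
      have "4 + u * (2 + d) + v * (2 * t + d * t ^ 2) = 0"
        using d unfolding u_def v_def t_def by (simp add: divide_simps) algebra
      then show ?thesis by simp
    qed
    finally show "Q (\<lambda>x. (c \<bullet> x) ^ 2) = \<dots>" .
  qed
qed

section \<open>Integrals of products of functions of single coordinates\<close>

lemma Basis_vec_axis: "(Basis :: (real ^ 'd::finite) set) = range (\<lambda>j. axis j 1)"
  by (auto simp: Basis_vec_def)

lemma inj_axis_1: "inj (\<lambda>j :: 'd::finite. axis j (1 :: real))"
  by (auto simp: inj_def axis_eq_axis)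

text \<open>The measure of the cylinder over a null set is a product with one factor 0; in the extended nonnegative reals this
  outweighs the infinite factors.\<close>

lemma AE_component_notin_null_set:
  fixes j :: "'d::finite"
  assumes "N \<in> null_sets (lborel :: real measure)"
  shows "AE x :: real ^ 'd in lborel. x $ j \<notin> N"
proof (rule AE_I')
  have N[measurable]: "N \<in> sets borel" using assms by (simp add: null_sets_def)
  define f :: "real ^ 'd \<Rightarrow> real \<Rightarrow> ennreal"
    where "f b = (if b = axis j 1 then indicator N else (\<lambda>_. 1))" for b
  have "(\<Prod>b\<in>Basis. f b (x \<bullet> b)) = indicator {x. x $ j \<in> N} x" for x
  proof -
    have "(\<Prod>b\<in>Basis. f b (x \<bullet> b)) = (\<Prod>i\<in>UNIV. if i = j then indicator N (x $ i) else 1)"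
      unfolding Basis_vec_axis prod.reindex[OF inj_axis_1]
      by (intro prod.cong) (simp_all add: f_def axis_eq_axis inner_axis)
    then show ?thesis by (simp add: indicator_def)
  qed
  then have "emeasure lborel {x :: real ^ 'd. x $ j \<in> N} = (\<integral>\<^sup>+x. (\<Prod>b\<in>Basis. f b (x \<bullet> b)) \<partial>lborel)"
    by (simp add: nn_integral_indicator)
  also have "\<dots> = (\<Prod>b\<in>Basis. (\<integral>\<^sup>+x. f b x \<partial>lborel))"
    by (rule nn_integral_lborel_prod) (auto simp: f_def)
  also have "\<dots> = 0"
  proof (rule prod_zero)
    show "\<exists>b\<in>Basis. (\<integral>\<^sup>+x. f b x \<partial>lborel) = 0"
      using assms by (intro bexI[of _ "axis j 1"]) (auto simp: f_def Basis_vec_axis null_sets_def)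
  qed simp
  finally show "{x :: real ^ 'd. x $ j \<in> N} \<in> null_sets lborel"
    by (auto simp: null_sets_def)
  show "{x \<in> space lborel. \<not> x $ j \<notin> N} \<subseteq> {x :: real ^ 'd. x $ j \<in> N}" by auto
qed

lemma lborel_integral_prod_components:
  fixes g :: "'d::finite \<Rightarrow> real \<Rightarrow> real"
  assumes g: "\<And>j. integrable lborel (g j)"
  shows "integrable lborel (\<lambda>x :: real ^ 'd. \<Prod>j\<in>UNIV. g j (x $ j))"
    and "(LINT x : UNIV | lborel. (\<Prod>j\<in>UNIV. g j ((x :: real ^ 'd) $ j))) = (\<Prod>j\<in>UNIV. integral\<^sup>L lborel (g j))"
proof -
  interpret product_sigma_finite "\<lambda>_ :: real ^ 'd. lborel :: real measure" ..
  have [measurable]: "g j \<in> borel_measurable borel" for j using g[of j] by auto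
  define \<gamma> :: "real ^ 'd \<Rightarrow> real \<Rightarrow> real" where "\<gamma> b = g (the_inv (\<lambda>j. axis j 1) b)" for b
  have \<gamma>: "\<gamma> (axis j 1) = g j" for j
    unfolding \<gamma>_def by (simp add: the_inv_f_f[OF inj_axis_1])
  have int: "integrable lborel (\<gamma> b)" for b unfolding \<gamma>_def by (rule g)
  let ?S = "\<lambda>f. \<Sum>b\<in>Basis. f b *\<^sub>R b :: real ^ 'd"
  let ?P = "\<Pi>\<^sub>M b\<in>(Basis :: (real ^ 'd) set). (lborel :: real measure)"
  have S[measurable]: "?S \<in> measurable ?P borel" by measurable
  have comp: "(\<Prod>j\<in>UNIV. g j (?S f $ j)) = (\<Prod>b\<in>Basis. \<gamma> b (f b))" for f
  proof -
    have "?S f $ j = f (axis j 1)" for j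
    proof -
      have "?S f $ j = ?S f \<bullet> axis j 1" by (simp add: inner_axis)
      also have "\<dots> = f (axis j 1)" by (rule inner_sum_left_Basis) (simp add: Basis_vec_axis)
      finally show ?thesis .
    qed
    then show ?thesis unfolding Basis_vec_axis prod.reindex[OF inj_axis_1] by (simp add: \<gamma>)
  qed
  have meas: "(\<lambda>x :: real ^ 'd. \<Prod>j\<in>UNIV. g j (x $ j)) \<in> borel_measurable borel" by measurable
  have "integrable ?P (\<lambda>f. \<Prod>b\<in>Basis. \<gamma> b (f b))"
    by (rule product_integrable_prod) (auto intro: int)
  then show "integrable lborel (\<lambda>x :: real ^ 'd. \<Prod>j\<in>UNIV. g j (x $ j))"
    by (subst lborel_eq, subst integrable_distr_eq[OF S meas]) (simp only: comp)
  have "integral\<^sup>L lborel (\<lambda>x :: real ^ 'd. \<Prod>j\<in>UNIV. g j (x $ j)) = integral\<^sup>L ?P (\<lambda>f. \<Prod>b\<in>Basis. \<gamma> b (f b))"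
    by (subst lborel_eq, subst integral_distr[OF S meas]) (simp only: comp)
  also have "\<dots> = (\<Prod>b\<in>Basis. integral\<^sup>L lborel (\<gamma> b))"
    by (rule product_integral_prod) (auto intro: int)
  also have "\<dots> = (\<Prod>j\<in>UNIV. integral\<^sup>L lborel (g j))"
    unfolding Basis_vec_axis prod.reindex[OF inj_axis_1] by (simp add: \<gamma>)
  finally show "(LINT x : UNIV | lborel. (\<Prod>j\<in>UNIV. g j ((x :: real ^ 'd) $ j))) = (\<Prod>j\<in>UNIV. integral\<^sup>L lborel (g j))"
    by (simp add: set_lebesgue_integral_def)
qed

text \<open>Lebesgue measure on a product is the completion of a product measure but not itself one. Each factor agrees almost
  everywhere with a Borel function, and exceptional sets of single coordinates stay null in the product.\<close>

lemma lebesgue_integral_prod_components: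
  fixes F :: "'d::finite \<Rightarrow> real \<Rightarrow> real"
  assumes F: "\<And>j. integrable lebesgue (F j)"
  shows "integrable lebesgue (\<lambda>x :: real ^ 'd. \<Prod>j\<in>UNIV. F j (x $ j))"
    and "integral\<^sup>L lebesgue (\<lambda>x :: real ^ 'd. \<Prod>j\<in>UNIV. F j (x $ j)) = (\<Prod>j\<in>UNIV. integral\<^sup>L lebesgue (F j))"
proof -
  have "\<exists>g \<in> borel_measurable lborel. AE x in lborel. F j x = g x" for j
    using F[of j] by (intro completion_ex_borel_measurable_real) auto
  then obtain g where g: "\<And>j. g j \<in> borel_measurable lborel" "\<And>j. AE x in lborel. F j x = g j x"
    by metis
  have gm[measurable]: "g j \<in> borel_measurable borel" for j using g(1)[of j] by simp
  have Fm: "F j \<in> borel_measurable lebesgue" for j using F[of j] by auto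
  have gl: "g j \<in> borel_measurable lebesgue" for j using g(1)[of j] by (rule measurable_completion)
  have gi: "integrable lebesgue (g j)" and ge: "integral\<^sup>L lebesgue (F j) = integral\<^sup>L lebesgue (g j)" for j
    using F[of j] integrable_cong_AE[OF Fm gl AE_completion[OF g(2)]] integral_cong_AE[OF Fm gl AE_completion[OF g(2)]]
    by auto
  have gb: "integrable lborel (g j)" for j using gi[of j] g(1)[of j] by (simp add: integrable_completion)
  have "AE x :: real ^ 'd in lborel. F j (x $ j) = g j (x $ j)" for j
  proof -
    obtain N where N: "{x. F j x \<noteq> g j x} \<subseteq> N" "N \<in> null_sets lborel"
      using g(2)[of j] by (auto simp: eventually_ae_filter)
    show ?thesis
      using AE_component_notin_null_set[OF N(2), of j] by (rule AE_mp) (use N(1) in auto)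
  qed
  then have "AE x :: real ^ 'd in lborel. \<forall>j\<in>UNIV. F j (x $ j) = g j (x $ j)"
    by (intro AE_finite_allI) auto
  then have "AE x :: real ^ 'd in lborel. (\<Prod>j\<in>UNIV. g j (x $ j)) = (\<Prod>j\<in>UNIV. F j (x $ j))"
    by (rule AE_mp) auto
  then have ae: "AE x :: real ^ 'd in lebesgue. (\<Prod>j\<in>UNIV. g j (x $ j)) = (\<Prod>j\<in>UNIV. F j (x $ j))"
    by (rule AE_completion)
  have Gm: "(\<lambda>x :: real ^ 'd. \<Prod>j\<in>UNIV. g j (x $ j)) \<in> borel_measurable lborel" by measurable
  then have Gl: "(\<lambda>x :: real ^ 'd. \<Prod>j\<in>UNIV. g j (x $ j)) \<in> borel_measurable lebesgue"
    by (rule measurable_completion)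
  have Pl: "(\<lambda>x :: real ^ 'd. \<Prod>j\<in>UNIV. F j (x $ j)) \<in> borel_measurable lebesgue"
    using borel_measurable_AE[OF Gl ae] .
  note prod = lborel_integral_prod_components[of g, OF gb]
  show "integrable lebesgue (\<lambda>x :: real ^ 'd. \<Prod>j\<in>UNIV. F j (x $ j))"
    using integrable_cong_AE[OF Gl Pl ae] prod(1) Gm by (simp add: integrable_completion)
  show "integral\<^sup>L lebesgue (\<lambda>x :: real ^ 'd. \<Prod>j\<in>UNIV. F j (x $ j)) = (\<Prod>j\<in>UNIV. integral\<^sup>L lebesgue (F j))"
    using integral_cong_AE[OF Gl Pl ae] prod(2) Gm
    by (simp add: integral_completion set_lebesgue_integral_def ge g(1))
qed

section \<open>Moments of product weights\<close>

text \<open>The factor that coordinate weight \<open>r\<close> on \<open>S\<close> contributes to the integral of a monomial.\<close>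

definition moment :: "real set \<Rightarrow> (real \<Rightarrow> real) \<Rightarrow> nat \<Rightarrow> real"
  where "moment S r a = (LINT x:S|lebesgue. x ^ a * r x)"

lemma moment_cong: "(\<And>x. x \<in> S \<Longrightarrow> r x = r' x) \<Longrightarrow> moment S r a = moment S r' a"
  unfolding moment_def set_lebesgue_integral_def by (rule Bochner_Integration.integral_cong) (auto simp: indicator_def)

lemma weighted_integral_monomial:
  fixes \<Omega> :: "'d::finite \<Rightarrow> real set"
  assumes int: "\<And>j a. set_integrable lebesgue (\<Omega> j) (\<lambda>x. x ^ a * \<rho> j x)"
  shows "set_integrable lebesgue (box_domain \<Omega>) (\<lambda>x. monomial \<alpha> x * product_weight \<rho> x)"
    and "weighted_integral (box_domain \<Omega>) (product_weight \<rho>) (monomial \<alpha>) = (\<Prod>j\<in>UNIV. moment (\<Omega> j) (\<rho> j) (\<alpha> j))"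
proof -
  define F where "F j x = indicator (\<Omega> j) x * (x ^ \<alpha> j * \<rho> j x)" for j x
  have F: "integrable lebesgue (F j)" for j
    using int[of j "\<alpha> j"] by (simp add: set_integrable_def F_def[abs_def])
  have eq: "indicator (box_domain \<Omega>) x *\<^sub>R (monomial \<alpha> x * product_weight \<rho> x) = (\<Prod>j\<in>UNIV. F j (x $ j))" for x
  proof -
    have "indicator (box_domain \<Omega>) x = (\<Prod>j\<in>UNIV. indicator (\<Omega> j) (x $ j) :: real)"
    proof (cases "x \<in> box_domain \<Omega>")
      case False
      then obtain j where "x $ j \<notin> \<Omega> j" by (auto simp: box_domain_def)
      then show ?thesis using False by (subst prod_zero) (auto intro!: exI[of _ j])
    qed (simp add: box_domain_def)
    then show ?thesis
      by (simp add: monomial_def product_weight_def F_def prod.distrib)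
  qed
  show "set_integrable lebesgue (box_domain \<Omega>) (\<lambda>x. monomial \<alpha> x * product_weight \<rho> x)"
    unfolding set_integrable_def eq by (rule lebesgue_integral_prod_components(1)[OF F])
  show "weighted_integral (box_domain \<Omega>) (product_weight \<rho>) (monomial \<alpha>) = (\<Prod>j\<in>UNIV. moment (\<Omega> j) (\<rho> j) (\<alpha> j))"
    unfolding weighted_integral_def set_lebesgue_integral_def eq lebesgue_integral_prod_components(2)[OF F]
    by (simp add: moment_def set_lebesgue_integral_def F_def[abs_def])
qed

lemma moment_odd:
  assumes "\<And>x. x \<in> S \<Longrightarrow> - x \<in> S" "\<And>x. x \<in> S \<Longrightarrow> r x = r (- x)" "odd a"
  shows "moment S r a = 0"
proof -
  have "- x \<in> S \<longleftrightarrow> x \<in> S" for x using assms(1)[of x] assms(1)[of "- x"] by auto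
  then have eq: "indicator S (- x) *\<^sub>R ((- x) ^ a * r (- x)) = - (indicator S x *\<^sub>R (x ^ a * r x))" for x
    using assms(2)[of x] assms(3) by (cases "x \<in> S") (simp_all add: indicator_def)
  have "moment S r a = (LINT x|lebesgue. indicator S (- x) *\<^sub>R ((- x) ^ a * r (- x)))"
    unfolding moment_def set_lebesgue_integral_def
    using lebesgue_integral_real_affine[of "-1" "\<lambda>x. indicator S x *\<^sub>R (x ^ a * r x)" 0] by simp
  also have "\<dots> = - moment S r a"
    unfolding eq moment_def set_lebesgue_integral_def by (rule Bochner_Integration.integral_minus)
  finally show ?thesis by simp
qed

lemma moment_even_nonneg:
  assumes "\<And>x. x \<in> S \<Longrightarrow> r x \<ge> 0" "even a"
  shows "moment S r a \<ge> 0"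
  unfolding moment_def set_lebesgue_integral_def
  using assms by (intro Bochner_Integration.integral_nonneg) (simp add: indicator_def zero_le_even_power)

text \<open>A nonnegative function with integral 0 vanishes almost everywhere.\<close>

lemma moment_0_eq_0_imp_all:
  assumes "set_integrable lebesgue S r" "\<And>x. x \<in> S \<Longrightarrow> r x \<ge> 0" "moment S r 0 = 0"
  shows "moment S r a = 0"
proof -
  have "AE x in lebesgue. indicator S x *\<^sub>R r x = 0"
    using assms integral_nonneg_eq_0_iff_AE[of lebesgue "\<lambda>x. indicator S x *\<^sub>R r x"]
    by (auto simp: moment_def set_lebesgue_integral_def set_integrable_def indicator_def)
  then have "AE x in lebesgue. indicator S x *\<^sub>R (x ^ a * r x) = 0"
    by (rule AE_mp) (auto simp: indicator_def)
  then show ?thesis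
    unfolding moment_def set_lebesgue_integral_def by (rule integral_eq_zero_AE)
qed

text \<open>A symmetric interval that contains no neighbourhood of 0 is contained in the null set \<open>{0}\<close>.\<close>

lemma moment_nonzero_imp_interval:
  assumes "is_interval S" "\<forall>x\<in>S. - x \<in> S" "moment S r 0 \<noteq> 0"
  obtains \<epsilon> where "\<epsilon> > 0" "{-\<epsilon>..\<epsilon>} \<subseteq> S"
proof -
  have "\<not> S \<subseteq> {0}"
  proof
    assume S: "S \<subseteq> {0}"
    have "AE x :: real in lebesgue. x \<noteq> 0"
      by (rule AE_completion) (rule AE_lborel_singleton)
    then have "AE x in lebesgue. indicator S x *\<^sub>R (x ^ 0 * r x) = 0"
      by (rule AE_mp) (use S in \<open>auto simp: indicator_def\<close>)
    then have "moment S r 0 = 0"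
      unfolding moment_def set_lebesgue_integral_def by (rule integral_eq_zero_AE)
    with assms(3) show False by contradiction
  qed
  then obtain x where "x \<in> S" "x \<noteq> 0" by auto
  with assms(2) have "\<bar>x\<bar> \<in> S" "- \<bar>x\<bar> \<in> S" by (auto simp: abs_if)
  then have "{- \<bar>x\<bar>..\<bar>x\<bar>} \<subseteq> S"
    using assms(1) unfolding is_interval_1 by (meson atLeastAtMost_iff subsetI)
  with \<open>x \<noteq> 0\<close> show thesis by (intro that[of "\<bar>x\<bar>"]) auto
qed

section \<open>From powers of linear forms to monomials\<close>

definition support :: "('d \<Rightarrow> nat) \<Rightarrow> 'd set"
  where "support \<alpha> = {j. \<alpha> j \<noteq> 0}"

lemma vanishes_on_odd_monomials:
  fixes Q :: "(real ^ 'd::finite \<Rightarrow> real) \<Rightarrow> real"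
  assumes Q: "cubature_formula UNIV n Q" and odd: "odd (\<alpha> i)"
    and inv: "\<And>c. Q (\<lambda>x. (flip i c \<bullet> x) ^ total_degree \<alpha>) = Q (\<lambda>x. (c \<bullet> x) ^ total_degree \<alpha>)"
  shows "Q (monomial \<alpha>) = 0"
proof -
  have "Q (monomial \<alpha>) = Q (\<lambda>x. monomial \<alpha> (flip i x))"
    by (rule invariant_on_monomials[OF Q inner_flip inv, symmetric])
  also have "\<dots> = - Q (monomial \<alpha>)"
    unfolding monomial_flip using cubature_formula_mult[OF Q, of "-1" "monomial \<alpha>"] odd by simp
  finally show ?thesis by simp
qed

lemma power_sum_axis_combination:
  assumes "i \<noteq> j" "i \<noteq> k" "j \<noteq> k" "m > 0"
  shows "power_sum m (u *\<^sub>R axis i 1 + v *\<^sub>R axis j 1 + w *\<^sub>R axis k 1) = u ^ m + v ^ m + w ^ m"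
proof -
  have "power_sum m (u *\<^sub>R axis i 1 + v *\<^sub>R axis j 1 + w *\<^sub>R axis k 1)
      = (\<Sum>l\<in>UNIV. (if l = i then u ^ m else 0) + (if l = j then v ^ m else 0) + (if l = k then w ^ m else 0))"
    unfolding power_sum_def using assms by (intro sum.cong) (auto simp: axis_def)
  then show ?thesis by (simp add: sum.distrib)
qed

lemma monomial_twice_indicator:
  "monomial (\<lambda>j. if j \<in> S then 2 else 0) x = (\<Prod>j\<in>S. (x $ j) ^ 2)"
proof -
  have "monomial (\<lambda>j. if j \<in> S then 2 else 0) x = (\<Prod>j\<in>UNIV. if j \<in> S then (x $ j) ^ 2 else 1)"
    unfolding monomial_def by (rule prod.cong) auto
  then show ?thesis by (simp add: prod.If_cases)
qed

text \<open>Applying the second difference with steps \<open>-1, 0, 1\<close> in each of \<open>u\<close>, \<open>v\<close>, \<open>w\<close> to \<open>(u X + v Y + w Z) ^ 6\<close> keeps only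
  monomials that are even and at least quadratic in each of \<open>X\<close>, \<open>Y\<close>, \<open>Z\<close>, and so isolates \<open>X\<^sup>2 Y\<^sup>2 Z\<^sup>2\<close>. On the side of the
  power sums, for the same reason, \<open>p\<^sub>2 p\<^sub>4\<close> and \<open>p\<^sub>6\<close> drop out, and only the coefficient of \<open>p\<^sub>2\<^sup>3\<close> is left.\<close>

lemma triple_square_coefficient:
  fixes Q :: "(real ^ 'd::finite \<Rightarrow> real) \<Rightarrow> real"
  assumes Q: "cubature_formula UNIV n Q"
    and pow: "\<And>c. Q (\<lambda>x. (c \<bullet> x) ^ 6) = 90 * power_sum 2 c ^ 3 + A * power_sum 2 c * power_sum 4 c + B * power_sum 6 c"
    and S: "card S = 3"
  shows "Q (monomial (\<lambda>j. if j \<in> S then 2 else 0)) = 6"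
proof -
  obtain i j k where ijk: "S = {i, j, k}" "i \<noteq> j" "i \<noteq> k" "j \<noteq> k"
    using S by (auto simp: card_3_iff)
  let ?M = "monomial (\<lambda>l. if l \<in> S then 2 else 0)"
  let ?E = "{-1, 0, 1 :: real} \<times> {-1, 0, 1 :: real} \<times> {-1, 0, 1 :: real}"
  \<comment> \<open>The second difference stencil: 1, -2, 1 at -1, 0, 1.\<close>
  define \<gamma> :: "real \<Rightarrow> real" where "\<gamma> u = 3 * u ^ 2 - 2" for u
  let ?c = "\<lambda>(u, v, w). u *\<^sub>R axis i 1 + v *\<^sub>R axis j 1 + w *\<^sub>R axis k 1 :: real ^ 'd"
  let ?\<gamma> = "\<lambda>(u, v, w). \<gamma> u * \<gamma> v * \<gamma> w"
  have "720 * ?M x = (\<Sum>e\<in>?E. ?\<gamma> e * (?c e \<bullet> x) ^ 6)" for x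
  proof -
    have "?M x = (x $ i * x $ j * x $ k) ^ 2"
      unfolding monomial_twice_indicator using ijk by (simp add: power_mult_distrib mult_ac)
    moreover have "(\<Sum>e\<in>?E. ?\<gamma> e * (case e of (u, v, w) \<Rightarrow> u * X + v * Y + w * Z) ^ 6) = 720 * (X * Y * Z) ^ 2"
      for X Y Z :: real
      unfolding sum.cartesian_product[symmetric] by (simp add: \<gamma>_def) algebra
    moreover have "?c e \<bullet> x = (case e of (u, v, w) \<Rightarrow> u * x $ i + v * x $ j + w * x $ k)" for e
      by (simp add: inner_add_left inner_axis' split: prod.split)
    ultimately show ?thesis by simp
  qed
  then have "720 * Q ?M = Q (\<lambda>x. \<Sum>e\<in>?E. ?\<gamma> e * (?c e \<bullet> x) ^ 6)"
    using cubature_formula_mult[OF Q, of 720 ?M] by simp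
  also have "\<dots> = (\<Sum>e\<in>?E. ?\<gamma> e * Q (\<lambda>x. (?c e \<bullet> x) ^ 6))"
    by (rule cubature_formula_linear[OF Q])
  also have "\<dots> = (\<Sum>e\<in>?E. case e of (u, v, w) \<Rightarrow> \<gamma> u * \<gamma> v * \<gamma> w *
      (90 * (u\<^sup>2 + v\<^sup>2 + w\<^sup>2) ^ 3 + A * (u\<^sup>2 + v\<^sup>2 + w\<^sup>2) * (u ^ 4 + v ^ 4 + w ^ 4) + B * (u ^ 6 + v ^ 6 + w ^ 6)))"
    unfolding pow by (rule sum.cong[OF refl]) (simp only: split_beta power_sum_axis_combination[OF ijk(2-4)] zero_less_numeral)
  also have "\<dots> = 4320"
    unfolding sum.cartesian_product[symmetric] by (simp add: \<gamma>_def)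
  finally show ?thesis by simp
qed

text \<open>The analogue of \<open>triple_square_coefficient\<close> with second differences in two variables.\<close>

lemma pair_square_coefficient:
  fixes Q :: "(real ^ 'd::finite \<Rightarrow> real) \<Rightarrow> real"
  assumes Q: "cubature_formula UNIV n Q"
    and pow: "\<And>c. Q (\<lambda>x. (c \<bullet> x) ^ 4) = 6 * power_sum 2 c ^ 2 + A * power_sum 4 c"
    and S: "card S = 2"
  shows "Q (monomial (\<lambda>j. if j \<in> S then 2 else 0)) = 2"
proof -
  obtain i j where ij: "S = {i, j}" "i \<noteq> j"
    using S by (auto simp: card_2_iff)
  let ?M = "monomial (\<lambda>l. if l \<in> S then 2 else 0)"
  let ?E = "{-1, 0, 1 :: real} \<times> {-1, 0, 1 :: real}"
  \<comment> \<open>The second difference stencil: 1, -2, 1 at -1, 0, 1.\<close>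
  define \<gamma> :: "real \<Rightarrow> real" where "\<gamma> u = 3 * u ^ 2 - 2" for u
  let ?c = "\<lambda>(u, v). u *\<^sub>R axis i 1 + v *\<^sub>R axis j 1 :: real ^ 'd"
  let ?\<gamma> = "\<lambda>(u, v). \<gamma> u * \<gamma> v"
  have p: "power_sum m (u *\<^sub>R axis i 1 + v *\<^sub>R axis j 1) = u ^ m + v ^ m" if "m > 0" for u v m
  proof -
    have "power_sum m (u *\<^sub>R axis i 1 + v *\<^sub>R axis j 1)
        = (\<Sum>l\<in>UNIV. (if l = i then u ^ m else 0) + (if l = j then v ^ m else 0))"
      unfolding power_sum_def using ij that by (intro sum.cong) (auto simp: axis_def)
    then show ?thesis by (simp add: sum.distrib)
  qed
  have "24 * ?M x = (\<Sum>e\<in>?E. ?\<gamma> e * (?c e \<bullet> x) ^ 4)" for x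
  proof -
    have "?M x = (x $ i * x $ j) ^ 2"
      unfolding monomial_twice_indicator using ij by (simp add: power_mult_distrib mult_ac)
    moreover have "(\<Sum>e\<in>?E. ?\<gamma> e * (case e of (u, v) \<Rightarrow> u * X + v * Y) ^ 4) = 24 * (X * Y) ^ 2"
      for X Y :: real
      unfolding sum.cartesian_product[symmetric] by (simp add: \<gamma>_def) algebra
    moreover have "?c e \<bullet> x = (case e of (u, v) \<Rightarrow> u * x $ i + v * x $ j)" for e
      by (simp add: inner_add_left inner_axis' split: prod.split)
    ultimately show ?thesis by simp
  qed
  then have "24 * Q ?M = Q (\<lambda>x. \<Sum>e\<in>?E. ?\<gamma> e * (?c e \<bullet> x) ^ 4)"
    using cubature_formula_mult[OF Q, of 24 ?M] by simp
  also have "\<dots> = (\<Sum>e\<in>?E. ?\<gamma> e * Q (\<lambda>x. (?c e \<bullet> x) ^ 4))"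
    by (rule cubature_formula_linear[OF Q])
  also have "\<dots> = (\<Sum>e\<in>?E. case e of (u, v) \<Rightarrow> \<gamma> u * \<gamma> v * (6 * (u\<^sup>2 + v\<^sup>2) ^ 2 + A * (u ^ 4 + v ^ 4)))"
    unfolding pow by (rule sum.cong[OF refl]) (simp only: split_beta p zero_less_numeral)
  also have "\<dots> = 48"
    unfolding sum.cartesian_product[symmetric] by (simp add: \<gamma>_def)
  finally show ?thesis by simp
qed

section \<open>Corrections on coordinate subspaces\<close>

text \<open>One downward step: \<open>Q\<close> is already right on monomials that involve more than \<open>r\<close> coordinates and on those with an odd
  exponent. A local correction for each \<open>S\<close> of size \<open>r\<close> that ignores odd monomials and monomials leaving \<open>S\<close> changes neither,
  and distinct sets of size \<open>r\<close> do not interfere with each other.\<close>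

lemma correct_support_size:
  fixes Q :: "(real ^ 'd::finite \<Rightarrow> real) \<Rightarrow> real" and I :: "('d \<Rightarrow> nat) \<Rightarrow> real"
  assumes Q: "cubature_formula D n Q"
    and exact: "\<forall>\<alpha>. total_degree \<alpha> \<le> l \<longrightarrow> card (support \<alpha>) \<ge> Suc r \<or> (\<exists>j. odd (\<alpha> j)) \<longrightarrow> Q (monomial \<alpha>) = I \<alpha>"
    and corr: "\<forall>S. card S = r \<longrightarrow> (\<exists>G. cubature_formula D m G
      \<and> (\<forall>\<alpha>. total_degree \<alpha> \<le> l \<longrightarrow> support \<alpha> = S \<longrightarrow> (\<forall>j. even (\<alpha> j)) \<longrightarrow> G (monomial \<alpha>) = I \<alpha> - Q (monomial \<alpha>))
      \<and> (\<forall>\<alpha>. \<not> support \<alpha> \<subseteq> S \<or> (\<exists>j. odd (\<alpha> j)) \<longrightarrow> G (monomial \<alpha>) = 0))"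
  obtains Q' where "cubature_formula D (n + (CARD('d) choose r) * m) Q'"
    "\<forall>\<alpha>. total_degree \<alpha> \<le> l \<longrightarrow> card (support \<alpha>) \<ge> r \<or> (\<exists>j. odd (\<alpha> j)) \<longrightarrow> Q' (monomial \<alpha>) = I \<alpha>"
proof -
  obtain G where G: "\<And>S. card S = r \<Longrightarrow> cubature_formula D m (G S)"
    "\<And>S \<alpha>. \<lbrakk>card S = r; total_degree \<alpha> \<le> l; support \<alpha> = S; \<forall>j. even (\<alpha> j)\<rbrakk> \<Longrightarrow> G S (monomial \<alpha>) = I \<alpha> - Q (monomial \<alpha>)"
    "\<And>S \<alpha>. \<lbrakk>card S = r; \<not> support \<alpha> \<subseteq> S \<or> (\<exists>j. odd (\<alpha> j))\<rbrakk> \<Longrightarrow> G S (monomial \<alpha>) = 0"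
    using corr by metis
  let ?Q' = "\<lambda>f. Q f + (\<Sum>S | card S = r. G S f)"
  show thesis
  proof
    have "cubature_formula D (card {S :: 'd set. card S = r} * m) (\<lambda>f. \<Sum>S | card S = r. G S f)"
      by (intro cubature_formula_sum) (auto intro: G(1))
    then show "cubature_formula D (n + (CARD('d) choose r) * m) ?Q'"
      using n_subsets[of "UNIV :: 'd set" r] by (intro cubature_formula_add Q) simp
  next
    show "\<forall>\<alpha>. total_degree \<alpha> \<le> l \<longrightarrow> card (support \<alpha>) \<ge> r \<or> (\<exists>j. odd (\<alpha> j)) \<longrightarrow> ?Q' (monomial \<alpha>) = I \<alpha>"
    proof (intro allI impI)
      fix \<alpha> :: "'d \<Rightarrow> nat"
      assume deg: "total_degree \<alpha> \<le> l" and a: "card (support \<alpha>) \<ge> r \<or> (\<exists>j. odd (\<alpha> j))"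
      show "?Q' (monomial \<alpha>) = I \<alpha>"
      proof (cases "card (support \<alpha>) = r \<and> (\<forall>j. even (\<alpha> j))")
        case True
        have "G S (monomial \<alpha>) = (if S = support \<alpha> then I \<alpha> - Q (monomial \<alpha>) else 0)" if "card S = r" for S
        proof (cases "S = support \<alpha>")
          case False
          then have "\<not> support \<alpha> \<subseteq> S"
            using True that by (metis card_subset_eq finite)
          then show ?thesis using G(3)[OF that] False by simp
        qed (use G(2)[OF that deg] True in auto)
        then show ?thesis using True by simp
      next
        case False
        have "G S (monomial \<alpha>) = 0" if "card S = r" for S
        proof (rule G(3)[OF that])
          show "\<not> support \<alpha> \<subseteq> S \<or> (\<exists>j. odd (\<alpha> j))"
            using False a that card_mono[of S "support \<alpha>"] by fastforce
        qed
        moreover have "Q (monomial \<alpha>) = I \<alpha>"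
          by (rule exact[rule_format, OF deg]) (use False a in auto)
        ultimately show ?thesis by simp
      qed
    qed
  qed
qed

lemma monomial_supported:
  fixes v :: "'d::finite \<Rightarrow> real"
  shows "monomial \<alpha> (\<chi> l. if l \<in> S then v l else 0)
    = (if support \<alpha> \<subseteq> S then \<Prod>l\<in>S. v l ^ \<alpha> l else 0)"
proof (cases "support \<alpha> \<subseteq> S")
  case True
  have "\<alpha> l = 0" if "l \<notin> S" for l using True that by (auto simp: support_def)
  then have "monomial \<alpha> (\<chi> l. if l \<in> S then v l else 0) = (\<Prod>l\<in>UNIV. if l \<in> S then v l ^ \<alpha> l else 1)"
    unfolding monomial_def by (intro prod.cong) auto
  then show ?thesis using True by (simp add: prod.If_cases)
next
  case False
  then obtain l where "\<alpha> l \<noteq> 0" "l \<notin> S" by (auto simp: support_def)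
  then have "monomial \<alpha> (\<chi> l. if l \<in> S then v l else 0) = 0"
    unfolding monomial_def by (intro prod_zero) (auto intro!: exI[of _ l])
  then show ?thesis using False by simp
qed

lemma support_le_total_degree: "\<alpha> i \<le> total_degree \<alpha>"
  unfolding total_degree_def by (rule member_le_sum) auto

lemma total_degree_support: "total_degree \<alpha> = sum \<alpha> (support \<alpha>)"
  unfolding total_degree_def support_def by (rule sum.mono_neutral_right) auto

lemma uminus_supported: "- (\<chi> l. if l \<in> S then v l else (0 :: real)) = (\<chi> l. if l \<in> S then - v l else 0)"
  by (simp add: vec_eq_iff)

text \<open>With \<open>k\<close> positive nodes, the even moments of orders \<open>2, 4, ..., 2 k\<close> can be prescribed.\<close>

lemma even_moment_nodes:
  fixes T :: "nat \<Rightarrow> real"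
  assumes "k \<in> {2, 3}"
  obtains v where "\<And>a. even a \<Longrightarrow> 0 < a \<Longrightarrow> a \<le> 2 * k \<Longrightarrow> (\<Sum>s=1..k. v s * real s ^ a) = T a"
proof (cases "k = 2")
  case True
  define v :: "nat \<Rightarrow> real" where "v s = (if s = 1 then (4 * T 2 - T 4) / 3 else (T 4 - T 2) / 12)" for s
  have "(\<Sum>s=1..k. v s * real s ^ a) = T a" if "even a" "0 < a" "a \<le> 2 * k" for a
  proof -
    from that True have "a = 2 \<or> a = 4" by presburger
    then show ?thesis using True by (auto simp: v_def numeral_2_eq_2 field_simps)
  qed
  then show thesis by (rule that)
next
  case False
  then have k: "k = 3" using assms by auto
  obtain x y z :: real where xyz: "x + 4 * y + 9 * z = T 2" "x + 16 * y + 81 * z = T 4" "x + 64 * y + 729 * z = T 6"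
    by (rule vandermonde_1_4_9)
  define v :: "nat \<Rightarrow> real" where "v s = (if s = 1 then x else if s = 2 then y else z)" for s
  have sum: "(\<Sum>s=1..k. v s * real s ^ a) = v 1 + v 2 * 2 ^ a + v 3 * 3 ^ a" for a
  proof -
    have "{1..k} = {1, 2, 3}" using k by auto
    then show ?thesis by simp
  qed
  have "(\<Sum>s=1..k. v s * real s ^ a) = T a" if "even a" "0 < a" "a \<le> 2 * k" for a
  proof -
    from that k have "a = 2 \<or> a = 4 \<or> a = 6" by presburger
    then show ?thesis unfolding sum using xyz by (elim disjE) (simp_all add: v_def mult.commute)
  qed
  then show thesis by (rule that)
qed

lemma axis_correction:
  fixes i :: "'d::finite" and R :: "nat \<Rightarrow> real"
  assumes k: "k \<in> {2, 3}" and \<delta>: "\<delta> > 0" and D: "{x. \<forall>j. \<bar>x $ j\<bar> \<le> 3 * \<delta>} \<subseteq> D"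
  shows "\<exists>G. cubature_formula D (2 * k) G
    \<and> (\<forall>\<alpha>. total_degree \<alpha> \<le> 2 * k + 1 \<longrightarrow> support \<alpha> = {i} \<longrightarrow> (\<forall>j. even (\<alpha> j)) \<longrightarrow> G (monomial \<alpha>) = R (\<alpha> i))
    \<and> (\<forall>\<alpha>. \<not> support \<alpha> \<subseteq> {i} \<or> (\<exists>j. odd (\<alpha> j)) \<longrightarrow> G (monomial \<alpha>) = 0)"
proof -
  obtain v where v: "\<And>a. even a \<Longrightarrow> 0 < a \<Longrightarrow> a \<le> 2 * k \<Longrightarrow> (\<Sum>s=1..k. v s * real s ^ a) = R a / (2 * \<delta> ^ a)"
    by (rule even_moment_nodes[OF k, where T = "\<lambda>a. R a / (2 * \<delta> ^ a)"]) blast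
  define y :: "nat \<Rightarrow> real ^ 'd" where "y s = (\<chi> l. if l \<in> {i} then real s * \<delta> else 0)" for s
  define G where "G f = (\<Sum>s=1..k. v s * antipodal (y s) f)" for f
  have mono: "antipodal (y s) (monomial \<alpha>)
      = (if support \<alpha> \<subseteq> {i} \<and> even (\<alpha> i) then 2 * (real s * \<delta>) ^ \<alpha> i else 0)" for s \<alpha>
    unfolding antipodal_def y_def uminus_supported monomial_supported by simp
  show ?thesis
  proof (intro exI conjI allI impI)
    have "cubature_formula D (card {1..k} * 2) G"
      unfolding G_def
    proof (intro cubature_formula_sum cubature_formula_scale cubature_formula_antipodal)
      fix s assume s: "s \<in> {1..k}"
      have "real s * \<delta> \<le> 3 * \<delta>" using s k \<delta> by auto
      then show "y s \<in> D" "- y s \<in> D" using \<delta> by (auto intro!: subsetD[OF D] simp: y_def)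
    qed simp
    then show "cubature_formula D (2 * k) G" by (simp add: mult.commute)
  next
    fix \<alpha> :: "'d \<Rightarrow> nat"
    assume \<alpha>: "total_degree \<alpha> \<le> 2 * k + 1" "support \<alpha> = {i}" "\<forall>j. even (\<alpha> j)"
    have "\<alpha> i \<le> 2 * k + 1" using support_le_total_degree[of \<alpha> i] \<alpha>(1) by simp
    moreover have "\<alpha> i \<noteq> 2 * k + 1" using \<alpha>(3) by (metis even_plus_one_iff even_mult_iff even_numeral)
    ultimately have a: "even (\<alpha> i)" "0 < \<alpha> i" "\<alpha> i \<le> 2 * k" using \<alpha>(2,3) by (auto simp: support_def)
    have "G (monomial \<alpha>) = (2 * \<delta> ^ \<alpha> i) * (\<Sum>s=1..k. v s * real s ^ \<alpha> i)"
      unfolding G_def mono sum_distrib_left using \<alpha>(2) a by (simp add: power_mult_distrib mult_ac)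
    also have "\<dots> = R (\<alpha> i)" unfolding v[OF a] using \<delta> by simp
    finally show "G (monomial \<alpha>) = R (\<alpha> i)" .
  next
    fix \<alpha> :: "'d \<Rightarrow> nat"
    assume \<alpha>: "\<not> support \<alpha> \<subseteq> {i} \<or> (\<exists>j. odd (\<alpha> j))"
    have neg: "\<not> (support \<alpha> \<subseteq> {i} \<and> even (\<alpha> i))"
    proof
      assume h: "support \<alpha> \<subseteq> {i} \<and> even (\<alpha> i)"
      then obtain l where l: "odd (\<alpha> l)" using \<alpha> by blast
      then have "l \<in> support \<alpha>" by (cases "\<alpha> l = 0") (auto simp: support_def)
      then have "l = i" using h by blast
      with h l show False by blast
    qed
    have zero: "antipodal (y s) (monomial \<alpha>) = 0" for s
      by (rule trans[OF mono if_not_P[OF neg]])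
    show "G (monomial \<alpha>) = 0"
      by (simp only: G_def zero mult_zero_right sum.neutral_const)
  qed
qed

text \<open>The four knots \<open>\<plusminus> x e\<^sub>i \<plusminus> y e\<^sub>j\<close>. The sign symmetry kills all monomials with an odd exponent.\<close>

definition grid :: "'d::finite \<Rightarrow> 'd \<Rightarrow> real \<Rightarrow> real \<Rightarrow> (real ^ 'd \<Rightarrow> real) \<Rightarrow> real"
  where "grid i j x y f =
    antipodal (\<chi> l. if l \<in> {i, j} then (if l = i then x else y) else 0) f
    + antipodal (\<chi> l. if l \<in> {i, j} then (if l = i then x else - y) else 0) f"

lemma grid_monomial:
  assumes "i \<noteq> j"
  shows "grid i j x y (monomial \<alpha>)
    = (if support \<alpha> \<subseteq> {i, j} \<and> even (\<alpha> i) \<and> even (\<alpha> j) then 4 * x ^ \<alpha> i * y ^ \<alpha> j else 0)"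
proof (cases "support \<alpha> \<subseteq> {i, j}")
  case True
  have "grid i j x y (monomial \<alpha>) = x ^ \<alpha> i * y ^ \<alpha> j + (- x) ^ \<alpha> i * (- y) ^ \<alpha> j
      + (x ^ \<alpha> i * (- y) ^ \<alpha> j + (- x) ^ \<alpha> i * (- (- y)) ^ \<alpha> j)"
    unfolding grid_def antipodal_def uminus_supported monomial_supported if_P[OF True]
    using assms by simp
  then show ?thesis
    unfolding if_P[OF True] using True by (cases "even (\<alpha> i)"; cases "even (\<alpha> j)"; simp)
next
  case False
  then show ?thesis
    unfolding grid_def antipodal_def uminus_supported monomial_supported if_not_P[OF False] by simp
qed

lemma cubature_formula_grid:
  assumes "{x. \<forall>j. \<bar>x $ j\<bar> \<le> b} \<subseteq> D" "\<bar>x\<bar> \<le> b" "\<bar>y\<bar> \<le> b"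
  shows "cubature_formula D 4 (grid i j x y)"
proof -
  have "cubature_formula D (2 + 2) (grid i j x y)"
    unfolding grid_def[abs_def] using assms(2,3)
    by (intro cubature_formula_add cubature_formula_antipodal subsetD[OF assms(1)]) auto
  then show ?thesis by simp
qed

text \<open>The monomials to be repaired have exponents \<open>(2, 2)\<close>, \<open>(4, 2)\<close> and \<open>(2, 4)\<close>. Grids with side ratios \<open>(1, 1)\<close>,
  \<open>(2, 1)\<close>, \<open>(1, 2)\<close> give a regular system. If the last two targets agree, square grids of two sizes suffice; this is where
  equal weights save knots.\<close>

lemma plane_correction:
  fixes i j :: "'d::finite" and R :: "nat \<Rightarrow> nat \<Rightarrow> real"
  assumes ij: "i \<noteq> j" and \<delta>: "\<delta> > 0" and D: "{x. \<forall>j. \<bar>x $ j\<bar> \<le> 3 * \<delta>} \<subseteq> D"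
    and g: "g = 3 \<or> g = 2 \<and> R 4 2 = R 2 4"
  shows "\<exists>G. cubature_formula D (4 * g) G
    \<and> (\<forall>\<alpha>. total_degree \<alpha> \<le> 7 \<longrightarrow> support \<alpha> = {i, j} \<longrightarrow> (\<forall>j. even (\<alpha> j)) \<longrightarrow> G (monomial \<alpha>) = R (\<alpha> i) (\<alpha> j))
    \<and> (\<forall>\<alpha>. \<not> support \<alpha> \<subseteq> {i, j} \<or> (\<exists>j. odd (\<alpha> j)) \<longrightarrow> G (monomial \<alpha>) = 0)"
proof -
  define s where "s a b = R a b / (4 * \<delta> ^ (a + b))" for a b
  have R: "R a b = 4 * \<delta> ^ (a + b) * s a b" for a b using \<delta> by (simp add: s_def)
  let ?even = "\<lambda>\<alpha>. support \<alpha> \<subseteq> {i, j} \<and> even (\<alpha> i) \<and> even (\<alpha> j)"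
  define grid' where "grid' p q = grid i j (p * \<delta>) (q * \<delta>)" for p q
  have grid': "grid' p q (monomial \<alpha>) = (if ?even \<alpha> then 4 * \<delta> ^ (\<alpha> i + \<alpha> j) * (p ^ \<alpha> i * q ^ \<alpha> j) else 0)" for p q \<alpha>
    by (simp add: grid'_def grid_monomial[OF ij] power_mult_distrib power_add)
  have knots: "cubature_formula D 4 (grid' p q)" if "p \<in> {1, 2}" "q \<in> {1, 2}" for p q
    unfolding grid'_def by (rule cubature_formula_grid[OF D]) (use that \<delta> in auto)
  have "\<exists>G. cubature_formula D (4 * g) G
    \<and> (\<forall>\<alpha>. (\<alpha> i, \<alpha> j) \<in> {(2, 2), (4, 2), (2, 4)} \<longrightarrow> support \<alpha> = {i, j} \<longrightarrow> G (monomial \<alpha>) = R (\<alpha> i) (\<alpha> j))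
    \<and> (\<forall>\<alpha>. \<not> ?even \<alpha> \<longrightarrow> G (monomial \<alpha>) = 0)"
    using g
  proof
    assume g: "g = 3"
    define u where "u = (s 4 2 - s 2 2) / 12"
    define v where "v = (s 2 4 - s 2 2) / 12"
    define G where "G f = (s 2 2 - 4 * u - 4 * v) * grid' 1 1 f + u * grid' 2 1 f + v * grid' 1 2 f" for f
    have "cubature_formula D (4 + 4 + 4) G"
      unfolding G_def by (intro cubature_formula_add cubature_formula_scale knots) auto
    moreover have "G (monomial \<alpha>) = R (\<alpha> i) (\<alpha> j)"
      if "(\<alpha> i, \<alpha> j) \<in> {(2, 2), (4, 2), (2, 4)}" "support \<alpha> = {i, j}" for \<alpha>
    proof -
      have "G (monomial \<alpha>) = 4 * \<delta> ^ (\<alpha> i + \<alpha> j)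
          * ((s 2 2 - 4 * u - 4 * v) + u * 2 ^ \<alpha> i + v * 2 ^ \<alpha> j)"
        using that by (auto simp: G_def grid' algebra_simps)
      also have "(s 2 2 - 4 * u - 4 * v) + u * 2 ^ \<alpha> i + v * 2 ^ \<alpha> j = s (\<alpha> i) (\<alpha> j)"
        using that(1) by (auto simp: u_def v_def field_simps)
      finally show ?thesis by (simp only: R)
    qed
    ultimately show ?thesis using g by (intro exI[of _ G]) (simp add: G_def grid')
  next
    assume g: "g = 2 \<and> R 4 2 = R 2 4"
    then have s: "s 2 4 = s 4 2" by (simp add: s_def)
    define u where "u = (s 4 2 - s 2 2) / 48"
    define G where "G f = (s 2 2 - 16 * u) * grid' 1 1 f + u * grid' 2 2 f" for f
    have "cubature_formula D (4 + 4) G"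
      unfolding G_def by (intro cubature_formula_add cubature_formula_scale knots) auto
    moreover have "G (monomial \<alpha>) = R (\<alpha> i) (\<alpha> j)"
      if "(\<alpha> i, \<alpha> j) \<in> {(2, 2), (4, 2), (2, 4)}" "support \<alpha> = {i, j}" for \<alpha>
    proof -
      have "G (monomial \<alpha>) = 4 * \<delta> ^ (\<alpha> i + \<alpha> j) * ((s 2 2 - 16 * u) + u * (2 ^ \<alpha> i * 2 ^ \<alpha> j))"
        using that by (auto simp: G_def grid' algebra_simps)
      also have "(s 2 2 - 16 * u) + u * (2 ^ \<alpha> i * 2 ^ \<alpha> j) = s (\<alpha> i) (\<alpha> j)"
        using that(1) s by (auto simp: u_def field_simps)
      finally show ?thesis by (simp only: R)
    qed
    ultimately show ?thesis using g by (intro exI[of _ G]) (simp add: G_def grid')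
  qed
  then obtain G where G: "cubature_formula D (4 * g) G"
    "\<And>\<alpha>. (\<alpha> i, \<alpha> j) \<in> {(2, 2), (4, 2), (2, 4)} \<Longrightarrow> support \<alpha> = {i, j} \<Longrightarrow> G (monomial \<alpha>) = R (\<alpha> i) (\<alpha> j)"
    "\<And>\<alpha>. \<not> (support \<alpha> \<subseteq> {i, j} \<and> even (\<alpha> i) \<and> even (\<alpha> j)) \<Longrightarrow> G (monomial \<alpha>) = 0"
    by metis
  show ?thesis
  proof (intro exI conjI allI impI)
    fix \<alpha> :: "'d \<Rightarrow> nat"
    assume \<alpha>: "total_degree \<alpha> \<le> 7" "support \<alpha> = {i, j}" "\<forall>j. even (\<alpha> j)"
    have "\<alpha> i + \<alpha> j \<le> 7" using \<alpha>(1,2) ij by (simp add: total_degree_support)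
    moreover have "\<alpha> i \<noteq> 0" "\<alpha> j \<noteq> 0" using \<alpha>(2) by (auto simp: support_def)
    moreover have "even (\<alpha> i)" "even (\<alpha> j)" using \<alpha>(3) by auto
    ultimately have "(\<alpha> i, \<alpha> j) \<in> {(2, 2), (4, 2), (2, 4)}" by simp presburger
    then show "G (monomial \<alpha>) = R (\<alpha> i) (\<alpha> j)" by (rule G(2)[OF _ \<alpha>(2)])
  next
    fix \<alpha> :: "'d \<Rightarrow> nat"
    assume \<alpha>: "\<not> support \<alpha> \<subseteq> {i, j} \<or> (\<exists>j. odd (\<alpha> j))"
    show "G (monomial \<alpha>) = 0"
    proof (rule G(3), rule notI)
      assume h: "support \<alpha> \<subseteq> {i, j} \<and> even (\<alpha> i) \<and> even (\<alpha> j)"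
      then obtain l where l: "odd (\<alpha> l)" using \<alpha> by blast
      then have "l \<in> support \<alpha>" by (cases "\<alpha> l = 0") (auto simp: support_def)
      then have "l = i \<or> l = j" using h by blast
      with h l show False by blast
    qed
  qed (rule G(1))
qed

section \<open>Exact formulas\<close>

text \<open>Each exponent is at least 2 on the support, and the sum of the exponents leaves no room for more.\<close>

lemma even_exponents_of_large_support:
  assumes deg: "total_degree \<alpha> \<le> 2 * k + 1" and card: "card (support \<alpha>) \<ge> k" and even: "\<And>j. even (\<alpha> j)"
  shows "card (support \<alpha>) = k" and "\<alpha> = (\<lambda>j. if j \<in> support \<alpha> then 2 else 0)"
proof -
  let ?S = "support \<alpha>"
  have two: "2 \<le> \<alpha> j" if "j \<in> ?S" for j
    using that even[of j] by (auto simp: support_def elim: evenE)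
  have "2 * card ?S + (\<Sum>j\<in>?S. \<alpha> j - 2) = (\<Sum>j\<in>?S. 2 + (\<alpha> j - 2))"
    by (simp only: sum.distrib sum_constant) simp
  also have "\<dots> = total_degree \<alpha>"
    unfolding total_degree_support using two by (intro sum.cong refl le_add_diff_inverse)
  finally have total: "2 * card ?S + (\<Sum>j\<in>?S. \<alpha> j - 2) \<le> 2 * k + 1" using deg by simp
  then show "card ?S = k" using card by linarith
  have excess: "(\<Sum>j\<in>?S. \<alpha> j - 2) \<le> 1" using total card by linarith
  have "\<alpha> j = 2" if j: "j \<in> ?S" for j
  proof -
    have "\<alpha> j - 2 \<le> (\<Sum>j\<in>?S. \<alpha> j - 2)" by (rule member_le_sum) (use j in auto)
    then have "\<alpha> j \<le> 3" using excess by linarith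
    moreover have "\<alpha> j \<noteq> 3" using even[of j] by auto
    ultimately show ?thesis using two[OF j] by linarith
  qed
  then show "\<alpha> = (\<lambda>j. if j \<in> ?S then 2 else 0)"
    by (auto simp: fun_eq_iff support_def)
qed

lemma monomial_scaled:
  fixes \<sigma> y :: "real ^ 'd::finite"
  shows "monomial \<alpha> (t *\<^sub>R (\<chi> j. \<sigma> $ j * y $ j)) = t ^ total_degree \<alpha> * monomial \<alpha> \<sigma> * monomial \<alpha> y"
  by (simp add: monomial_def total_degree_def power_mult_distrib prod.distrib power_sum)

text \<open>On monomials the rescaled functional differs from \<open>Q\<close> by factors that depend only on the exponents, so odd monomials stay
  annihilated. On products of \<open>k\<close> squares the stretching by \<open>\<sigma>\<close> supplies the quotients of second and zeroth moments and \<open>K\<close> the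
  rest. The third conclusion records that equal weights preserve the symmetry of the design under exchange of coordinates.\<close>

lemma scaled_main_part:
  fixes Q :: "(real ^ 'd::finite \<Rightarrow> real) \<Rightarrow> real" and m :: "'d \<Rightarrow> nat \<Rightarrow> real"
  assumes Q: "cubature_formula UNIV n Q"
    and Qodd: "\<forall>\<alpha> i. total_degree \<alpha> \<le> 2 * k + 1 \<longrightarrow> odd (\<alpha> i) \<longrightarrow> Q (monomial \<alpha>) = 0"
    and Qsq: "\<forall>S. card S = k \<longrightarrow> Q (monomial (\<lambda>j. if j \<in> S then 2 else 0)) = \<kappa>" and \<kappa>: "\<kappa> \<noteq> 0"
    and D: "ball 0 \<epsilon> \<subseteq> D" "\<epsilon> > 0"
    and m': "\<forall>j. m j 0 > 0" "\<forall>j. m j 2 \<ge> 0" "\<forall>j a. odd a \<longrightarrow> m j a = 0"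
  obtains Q' where "cubature_formula D n Q'"
    and "\<forall>\<alpha>. total_degree \<alpha> \<le> 2 * k + 1 \<longrightarrow> card (support \<alpha>) \<ge> k \<or> (\<exists>j. odd (\<alpha> j)) \<longrightarrow>
        Q' (monomial \<alpha>) = (\<Prod>j\<in>UNIV. m j (\<alpha> j))"
    and "(\<forall>i j. m i = m j) \<longrightarrow> (\<forall>\<alpha> i j. Q (monomial (\<alpha> \<circ> Transposition.transpose i j)) = Q (monomial \<alpha>) \<longrightarrow>
        Q' (monomial (\<alpha> \<circ> Transposition.transpose i j)) = Q' (monomial \<alpha>))"
proof -
  note m = m'[rule_format]
  define \<sigma> :: "real ^ 'd" where "\<sigma> = (\<chi> j. sqrt (m j 2 / m j 0))"
  obtain t where t: "t > 0" "cubature_formula D n (\<lambda>f. Q (\<lambda>y. f (t *\<^sub>R (\<chi> j. \<sigma> $ j * y $ j))))"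
    using cubature_formula_shrink[OF Q D] .
  define K where "K = (\<Prod>j\<in>UNIV. m j 0) / (\<kappa> * t ^ (2 * k))"
  define Q' where "Q' f = K * Q (\<lambda>y. f (t *\<^sub>R (\<chi> j. \<sigma> $ j * y $ j)))" for f
  have mono: "Q' (monomial \<alpha>) = K * (t ^ total_degree \<alpha> * monomial \<alpha> \<sigma> * Q (monomial \<alpha>))" for \<alpha>
    unfolding Q'_def monomial_scaled cubature_formula_mult[OF Q] by simp
  show thesis
  proof
    show "cubature_formula D n Q'"
      unfolding Q'_def by (rule cubature_formula_scale[OF t(2)])
  next
    show "\<forall>\<alpha>. total_degree \<alpha> \<le> 2 * k + 1 \<longrightarrow> card (support \<alpha>) \<ge> k \<or> (\<exists>j. odd (\<alpha> j)) \<longrightarrow>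
        Q' (monomial \<alpha>) = (\<Prod>j\<in>UNIV. m j (\<alpha> j))"
    proof (intro allI impI)
      fix \<alpha> :: "'d \<Rightarrow> nat"
      assume deg: "total_degree \<alpha> \<le> 2 * k + 1" and a: "card (support \<alpha>) \<ge> k \<or> (\<exists>j. odd (\<alpha> j))"
      show "Q' (monomial \<alpha>) = (\<Prod>j\<in>UNIV. m j (\<alpha> j))"
      proof (cases "\<exists>j. odd (\<alpha> j)")
        case True
        then obtain j where j: "odd (\<alpha> j)" by blast
        have "(\<Prod>j\<in>UNIV. m j (\<alpha> j)) = 0"
          using m(3)[OF j] by (intro prod_zero) auto
        then show ?thesis using Qodd[rule_format, OF deg j] by (simp add: mono)
      next
        case False
        then have even: "\<And>j. even (\<alpha> j)" by blast
        have card: "card (support \<alpha>) \<ge> k" using a False by blast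
        define S where "S = support \<alpha>"
        note \<alpha> = even_exponents_of_large_support[OF deg card even, folded S_def]
        have total: "total_degree \<alpha> = 2 * k"
          by (subst \<alpha>(2)) (simp add: total_degree_def sum.If_cases \<alpha>(1))
        have "monomial \<alpha> \<sigma> = (\<Prod>j\<in>S. m j 2 / m j 0)"
        proof -
          have "monomial \<alpha> \<sigma> = (\<Prod>j\<in>S. (\<sigma> $ j) ^ 2)"
            by (subst \<alpha>(2)) (rule monomial_twice_indicator)
          then show ?thesis using m(1,2) by (simp add: \<sigma>_def less_imp_le)
        qed
        moreover have "Q (monomial \<alpha>) = \<kappa>"
          by (subst \<alpha>(2)) (rule Qsq[rule_format, OF \<alpha>(1)])
        moreover have "(\<Prod>j\<in>UNIV. m j (\<alpha> j)) = (\<Prod>j\<in>UNIV. m j 0) * (\<Prod>j\<in>S. m j 2 / m j 0)"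
        proof -
          have "(\<Prod>j\<in>UNIV. m j (\<alpha> j)) = (\<Prod>j\<in>UNIV. m j 0 * (if j \<in> S then m j 2 / m j 0 else 1))"
          proof (rule prod.cong[OF refl])
            fix j show "m j (\<alpha> j) = m j 0 * (if j \<in> S then m j 2 / m j 0 else 1)"
              using m(1)[of j] by (subst \<alpha>(2)) auto
          qed
          then show ?thesis by (simp add: prod.distrib prod.If_cases)
        qed
        ultimately show ?thesis
          using \<kappa> t(1) by (simp add: mono total K_def)
      qed
    qed
  next
    show "(\<forall>i j. m i = m j) \<longrightarrow> (\<forall>\<alpha> i j. Q (monomial (\<alpha> \<circ> Transposition.transpose i j)) = Q (monomial \<alpha>) \<longrightarrow>
        Q' (monomial (\<alpha> \<circ> Transposition.transpose i j)) = Q' (monomial \<alpha>))"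
    proof (intro allI impI)
      fix \<alpha> :: "'d \<Rightarrow> nat" and i j :: 'd
      assume eq: "\<forall>i j. m i = m j" and sym: "Q (monomial (\<alpha> \<circ> Transposition.transpose i j)) = Q (monomial \<alpha>)"
      have "m (Transposition.transpose i j l) = m l" for l by (rule eq[rule_format])
      then have "swap_coords i j \<sigma> = \<sigma>"
        by (simp add: swap_coords_def \<sigma>_def vec_eq_iff)
      then have "monomial (\<alpha> \<circ> Transposition.transpose i j) \<sigma> = monomial \<alpha> \<sigma>"
        by (metis monomial_swap_coords)
      moreover have "total_degree (\<alpha> \<circ> Transposition.transpose i j) = total_degree \<alpha>"
        unfolding total_degree_def
        by (rule sum.reindex_bij_witness[of _ "Transposition.transpose i j" "Transposition.transpose i j"]) auto
      ultimately show "Q' (monomial (\<alpha> \<circ> Transposition.transpose i j)) = Q' (monomial \<alpha>)"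
        by (simp add: mono sym)
    qed
  qed
qed

text \<open>The last two downward steps, with \<open>k\<close> antipodal pairs on each axis and finally the origin.\<close>

lemma exact_up_to_axes:
  fixes Q :: "(real ^ 'd::finite \<Rightarrow> real) \<Rightarrow> real"
  assumes k: "k \<in> {2, 3}" and \<delta>: "\<delta> > 0" and D: "{x. \<forall>j. \<bar>x $ j\<bar> \<le> 3 * \<delta>} \<subseteq> D"
    and Q: "cubature_formula D n Q"
    and exact: "\<forall>\<alpha>. total_degree \<alpha> \<le> 2 * k + 1 \<longrightarrow> card (support \<alpha>) \<ge> 2 \<or> (\<exists>j. odd (\<alpha> j)) \<longrightarrow>
        Q (monomial \<alpha>) = I \<alpha>"
  obtains Q' where "cubature_formula D (n + 2 * k * CARD('d) + 1) Q'"
    and "\<forall>\<alpha>. total_degree \<alpha> \<le> 2 * k + 1 \<longrightarrow> Q' (monomial \<alpha>) = I \<alpha>"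
proof -
  have axis: "\<exists>G. cubature_formula D (2 * k) G
      \<and> (\<forall>\<alpha>. total_degree \<alpha> \<le> 2 * k + 1 \<longrightarrow> support \<alpha> = S \<longrightarrow> (\<forall>j. even (\<alpha> j)) \<longrightarrow> G (monomial \<alpha>) = I \<alpha> - Q (monomial \<alpha>))
      \<and> (\<forall>\<alpha>. \<not> support \<alpha> \<subseteq> S \<or> (\<exists>j. odd (\<alpha> j)) \<longrightarrow> G (monomial \<alpha>) = 0)"
    if S: "card S = 1" for S
  proof -
    obtain i where i: "S = {i}" using S by (auto simp: card_1_singleton_iff)
    let ?e = "\<lambda>a l. if l = i then a else 0"
    have \<alpha>: "\<alpha> = ?e (\<alpha> i)" if "support \<alpha> = {i}" for \<alpha>
    proof
      fix l
      have "l \<in> support \<alpha> \<longleftrightarrow> l = i" using that by blast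
      then show "\<alpha> l = ?e (\<alpha> i) l" by (auto simp: support_def)
    qed
    obtain G where G: "cubature_formula D (2 * k) G"
      "\<forall>\<alpha>. total_degree \<alpha> \<le> 2 * k + 1 \<longrightarrow> support \<alpha> = {i} \<longrightarrow> (\<forall>j. even (\<alpha> j)) \<longrightarrow>
        G (monomial \<alpha>) = I (?e (\<alpha> i)) - Q (monomial (?e (\<alpha> i)))"
      "\<forall>\<alpha>. \<not> support \<alpha> \<subseteq> {i} \<or> (\<exists>j. odd (\<alpha> j)) \<longrightarrow> G (monomial \<alpha>) = 0"
      using axis_correction[OF k \<delta> D, of i "\<lambda>a. I (?e a) - Q (monomial (?e a))"]
      by (elim exE conjE) (rule that)
    show ?thesis unfolding i
    proof (intro exI conjI)
      show "\<forall>\<alpha>. total_degree \<alpha> \<le> 2 * k + 1 \<longrightarrow> support \<alpha> = {i} \<longrightarrow> (\<forall>j. even (\<alpha> j)) \<longrightarrow>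
          G (monomial \<alpha>) = I \<alpha> - Q (monomial \<alpha>)"
      proof (intro allI impI)
        fix \<alpha> :: "'d \<Rightarrow> nat"
        assume deg: "total_degree \<alpha> \<le> 2 * k + 1" and supp: "support \<alpha> = {i}" and even: "\<forall>j. even (\<alpha> j)"
        show "G (monomial \<alpha>) = I \<alpha> - Q (monomial \<alpha>)"
          using G(2)[rule_format, OF deg supp even[rule_format]] by (simp only: \<alpha>[OF supp, symmetric])
      qed
    qed (rule G(1) G(3))+
  qed
  obtain Q1 where Q1: "cubature_formula D (n + (CARD('d) choose 1) * (2 * k)) Q1"
    "\<forall>\<alpha>. total_degree \<alpha> \<le> 2 * k + 1 \<longrightarrow> card (support \<alpha>) \<ge> 1 \<or> (\<exists>j. odd (\<alpha> j)) \<longrightarrow> Q1 (monomial \<alpha>) = I \<alpha>"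
    by (rule correct_support_size[OF Q, of "2 * k + 1" 1 I "2 * k"])
       (use exact axis in \<open>simp_all add: numeral_2_eq_2\<close>)
  have origin: "\<exists>G. cubature_formula D 1 G
      \<and> (\<forall>\<alpha>. total_degree \<alpha> \<le> 2 * k + 1 \<longrightarrow> support \<alpha> = S \<longrightarrow> (\<forall>j. even (\<alpha> j)) \<longrightarrow> G (monomial \<alpha>) = I \<alpha> - Q1 (monomial \<alpha>))
      \<and> (\<forall>\<alpha>. \<not> support \<alpha> \<subseteq> S \<or> (\<exists>j. odd (\<alpha> j)) \<longrightarrow> G (monomial \<alpha>) = 0)"
    if S: "card S = 0" for S
  proof -
    have S: "S = {}" using S by simp
    have mono0: "monomial \<alpha> 0 = (if support \<alpha> = {} then 1 else 0)" for \<alpha> :: "'d \<Rightarrow> nat"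
      using monomial_supported[of \<alpha> "{}" "\<lambda>_. 0"] by (simp add: zero_vec_def)
    have "cubature_formula D 1 (\<lambda>f. (I (\<lambda>_. 0) - Q1 (monomial (\<lambda>_. 0))) * f 0)"
      using \<delta> by (intro cubature_formula_scale cubature_formula_point subsetD[OF D]) auto
    moreover have "\<alpha> = (\<lambda>_. 0)" if "support \<alpha> = {}" for \<alpha> :: "'d \<Rightarrow> nat"
      using that by (auto simp: support_def)
    moreover have "support \<alpha> \<noteq> {}" if "odd (\<alpha> j)" for \<alpha> :: "'d \<Rightarrow> nat" and j
      using that by (cases "\<alpha> j = 0") (auto simp: support_def)
    ultimately show ?thesis unfolding S
      by (intro exI[of _ "\<lambda>f. (I (\<lambda>_. 0) - Q1 (monomial (\<lambda>_. 0))) * f 0"]) (auto simp: mono0)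
  qed
  obtain Q2 where Q2: "cubature_formula D (n + (CARD('d) choose 1) * (2 * k) + (CARD('d) choose 0) * 1) Q2"
    "\<forall>\<alpha>. total_degree \<alpha> \<le> 2 * k + 1 \<longrightarrow> card (support \<alpha>) \<ge> 0 \<or> (\<exists>j. odd (\<alpha> j)) \<longrightarrow> Q2 (monomial \<alpha>) = I \<alpha>"
    by (rule correct_support_size[OF Q1(1), of "2 * k + 1" 0 I 1])
       (use Q1(2) origin in simp_all)
  show thesis
  proof
    show "cubature_formula D (n + 2 * k * CARD('d) + 1) Q2"
      using Q2(1) by (rule back_subst[of "\<lambda>n. cubature_formula D n Q2"]) simp
  qed (use Q2(2) in simp)
qed

lemma exact_of_degree_if_monomials:
  fixes Q :: "(real ^ 'd::finite \<Rightarrow> real) \<Rightarrow> real"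
  assumes Q: "cubature_formula D' n Q"
    and int: "\<And>\<alpha> :: 'd \<Rightarrow> nat. set_integrable lebesgue D (\<lambda>x. monomial \<alpha> x * w x)"
    and mono: "\<And>\<alpha>. total_degree \<alpha> \<le> l \<Longrightarrow> Q (monomial \<alpha>) = weighted_integral D w (monomial \<alpha>)"
  shows "exact_of_degree l (weighted_integral D w) Q"
  unfolding exact_of_degree_def
proof
  fix f :: "real ^ 'd \<Rightarrow> real" assume "f \<in> poly_space l"
  then obtain c where f: "f = (\<lambda>x. \<Sum>\<alpha>\<in>multi_indices l. c \<alpha> * monomial \<alpha> x)"
    unfolding poly_space_def monomial_def by blast
  have "weighted_integral D w f = (LINT x|lebesgue. (\<Sum>\<alpha>\<in>multi_indices l. c \<alpha> * (indicator D x *\<^sub>R (monomial \<alpha> x * w x))))"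
    unfolding weighted_integral_def set_lebesgue_integral_def f
    by (intro Bochner_Integration.integral_cong refl) (simp add: sum_distrib_left sum_distrib_right mult_ac)
  also have "\<dots> = (\<Sum>\<alpha>\<in>multi_indices l. LINT x|lebesgue. c \<alpha> * (indicator D x *\<^sub>R (monomial \<alpha> x * w x)))"
    using int by (intro Bochner_Integration.integral_sum integrable_mult_right) (simp add: set_integrable_def)
  also have "\<dots> = (\<Sum>\<alpha>\<in>multi_indices l. c \<alpha> * weighted_integral D w (monomial \<alpha>))"
    by (simp only: integral_mult_right_zero weighted_integral_def set_lebesgue_integral_def)
  also have "\<dots> = (\<Sum>\<alpha>\<in>multi_indices l. c \<alpha> * Q (monomial \<alpha>))"
    by (intro sum.cong refl) (simp add: mono multi_indices_def total_degree_def)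
  also have "\<dots> = Q f" unfolding f by (rule cubature_formula_linear[OF Q, symmetric])
  finally show "Q f = weighted_integral D w f" ..
qed

lemma ball_subset_if_cube_subset:
  assumes "{x :: real ^ 'd::finite. \<forall>j. \<bar>x $ j\<bar> \<le> b} \<subseteq> D"
  shows "ball 0 b \<subseteq> D"
proof
  fix x :: "real ^ 'd" assume "x \<in> ball 0 b"
  then have "norm x \<le> b" by simp
  then have "\<bar>x $ j\<bar> \<le> b" for j using component_le_norm_cart[of x j] by linarith
  then show "x \<in> D" using assms by blast
qed

lemma moment_formula_degree_5:
  fixes m :: "'d::finite \<Rightarrow> nat \<Rightarrow> real"
  assumes \<delta>: "\<delta> > 0" and D: "{x. \<forall>j. \<bar>x $ j\<bar> \<le> 3 * \<delta>} \<subseteq> D"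
    and m: "\<forall>j. m j 0 > 0" "\<forall>j. m j 2 \<ge> 0" "\<forall>j a. odd a \<longrightarrow> m j a = 0"
  obtains Q where "cubature_formula D ((CARD('d) choose 2) * 2 + 4 * CARD('d) + 4 * CARD('d) + 1) Q"
    and "\<forall>\<alpha>. total_degree \<alpha> \<le> 5 \<longrightarrow> Q (monomial \<alpha>) = (\<Prod>j\<in>UNIV. m j (\<alpha> j))"
proof -
  obtain M :: "(real ^ 'd \<Rightarrow> real) \<Rightarrow> real" and A B where M:
    "cubature_formula UNIV ((CARD('d) choose 2) * 2 + 4 * CARD('d)) M"
    "\<And>c m. odd m \<Longrightarrow> M (\<lambda>x. (c \<bullet> x) ^ m) = 0"
    "\<And>c. M (\<lambda>x. (c \<bullet> x) ^ 4) = 6 * power_sum 2 c ^ 2 + A * power_sum 4 c"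
    "\<And>c. M (\<lambda>x. (c \<bullet> x) ^ 2) = B * power_sum 2 c"
    by (rule main_part_degree_5[where ?'d = 'd]) (rule that; (assumption | simp))
  have odd: "M (monomial \<alpha>) = 0" if deg: "total_degree \<alpha> \<le> 2 * 2 + 1" and odd: "odd (\<alpha> i)" for \<alpha> :: "'d \<Rightarrow> nat" and i
  proof (rule vanishes_on_odd_monomials[where i = i and \<alpha> = \<alpha>, OF M(1) odd])
    fix c :: "real ^ 'd"
    have "odd n \<or> n = 0 \<or> n = 2 \<or> n = 4" if "n \<le> 2 * 2 + 1" for n :: nat
      using that by presburger
    from this[OF deg] show "M (\<lambda>x. (flip i c \<bullet> x) ^ total_degree \<alpha>) = M (\<lambda>x. (c \<bullet> x) ^ total_degree \<alpha>)"
      by (elim disjE) (simp_all add: M(2-4) power_sum_flip)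
  qed
  then have odd': "\<forall>\<alpha> i. total_degree \<alpha> \<le> 2 * 2 + 1 \<longrightarrow> odd (\<alpha> i) \<longrightarrow> M (monomial \<alpha>) = 0" by blast
  have square: "\<forall>S. card S = 2 \<longrightarrow> M (monomial (\<lambda>j. if j \<in> S then 2 else 0)) = 2"
    by (intro allI impI pair_square_coefficient[OF M(1,3)])
  have "3 * \<delta> > 0" using \<delta> by simp
  obtain Q0 where Q0: "cubature_formula D ((CARD('d) choose 2) * 2 + 4 * CARD('d)) Q0"
    "\<forall>\<alpha>. total_degree \<alpha> \<le> 2 * 2 + 1 \<longrightarrow> card (support \<alpha>) \<ge> 2 \<or> (\<exists>j. odd (\<alpha> j)) \<longrightarrow>
        Q0 (monomial \<alpha>) = (\<Prod>j\<in>UNIV. m j (\<alpha> j))"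
    by (rule scaled_main_part[OF M(1) odd' square _ ball_subset_if_cube_subset[OF D] \<open>3 * \<delta> > 0\<close> m]) simp
  obtain Q where "cubature_formula D ((CARD('d) choose 2) * 2 + 4 * CARD('d) + 2 * 2 * CARD('d) + 1) Q"
    "\<forall>\<alpha>. total_degree \<alpha> \<le> 2 * 2 + 1 \<longrightarrow> Q (monomial \<alpha>) = (\<Prod>j\<in>UNIV. m j (\<alpha> j))"
    by (rule exact_up_to_axes[OF _ \<delta> D Q0(1,2)]) simp
  then show thesis by (intro that[of Q]) simp_all
qed

lemma moment_formula_degree_7:
  fixes m :: "'d::finite \<Rightarrow> nat \<Rightarrow> real"
  assumes \<delta>: "\<delta> > 0" and D: "{x. \<forall>j. \<bar>x $ j\<bar> \<le> 3 * \<delta>} \<subseteq> D"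
    and m: "\<forall>j. m j 0 > 0" "\<forall>j. m j 2 \<ge> 0" "\<forall>j a. odd a \<longrightarrow> m j a = 0"
    and g: "g = 3 \<or> g = 2 \<and> (\<forall>i j. m i = m j)"
  obtains Q where "cubature_formula D ((CARD('d) choose 3) * 2 + (CARD('d) choose 2) * 6 + (12 * CARD('d) + 6)
      + (CARD('d) choose 2) * (4 * g) + 6 * CARD('d) + 1) Q"
    and "\<forall>\<alpha>. total_degree \<alpha> \<le> 7 \<longrightarrow> Q (monomial \<alpha>) = (\<Prod>j\<in>UNIV. m j (\<alpha> j))"
proof -
  let ?n = "(CARD('d) choose 3) * 2 + (CARD('d) choose 2) * 6 + (12 * CARD('d) + 6)"
  let ?I = "\<lambda>\<alpha>. \<Prod>j\<in>UNIV. m j (\<alpha> j)"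
  obtain M :: "(real ^ 'd \<Rightarrow> real) \<Rightarrow> real" and A B C E F where M:
    "cubature_formula UNIV ?n M"
    "\<And>c m. odd m \<Longrightarrow> M (\<lambda>x. (c \<bullet> x) ^ m) = 0"
    "\<And>c. M (\<lambda>x. (c \<bullet> x) ^ 6) = 90 * power_sum 2 c ^ 3 + A * power_sum 2 c * power_sum 4 c + B * power_sum 6 c"
    "\<And>c. M (\<lambda>x. (c \<bullet> x) ^ 4) = C * power_sum 2 c ^ 2 + E * power_sum 4 c"
    "\<And>c. M (\<lambda>x. (c \<bullet> x) ^ 2) = F * power_sum 2 c"
    by (rule main_part_degree_7[where ?'d = 'd]) (rule that; (assumption | simp))
  have odd: "M (monomial \<alpha>) = 0" if deg: "total_degree \<alpha> \<le> 2 * 3 + 1" and odd: "odd (\<alpha> i)" for \<alpha> :: "'d \<Rightarrow> nat" and i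
  proof (rule vanishes_on_odd_monomials[where i = i and \<alpha> = \<alpha>, OF M(1) odd])
    fix c :: "real ^ 'd"
    have "odd n \<or> n = 0 \<or> n = 2 \<or> n = 4 \<or> n = 6" if "n \<le> 2 * 3 + 1" for n :: nat
      using that by presburger
    from this[OF deg] show "M (\<lambda>x. (flip i c \<bullet> x) ^ total_degree \<alpha>) = M (\<lambda>x. (c \<bullet> x) ^ total_degree \<alpha>)"
      by (elim disjE) (simp_all add: M(2-5) power_sum_flip)
  qed
  then have odd': "\<forall>\<alpha> i. total_degree \<alpha> \<le> 2 * 3 + 1 \<longrightarrow> odd (\<alpha> i) \<longrightarrow> M (monomial \<alpha>) = 0" by blast
  have square: "\<forall>S. card S = 3 \<longrightarrow> M (monomial (\<lambda>j. if j \<in> S then 2 else 0)) = 6"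
    by (intro allI impI triple_square_coefficient[OF M(1,3)])
  have "3 * \<delta> > 0" using \<delta> by simp
  obtain Q0 where Q0: "cubature_formula D ?n Q0"
    "\<forall>\<alpha>. total_degree \<alpha> \<le> 2 * 3 + 1 \<longrightarrow> card (support \<alpha>) \<ge> 3 \<or> (\<exists>j. odd (\<alpha> j)) \<longrightarrow> Q0 (monomial \<alpha>) = ?I \<alpha>"
    "(\<forall>i j. m i = m j) \<longrightarrow> (\<forall>\<alpha> i j. M (monomial (\<alpha> \<circ> Transposition.transpose i j)) = M (monomial \<alpha>) \<longrightarrow>
        Q0 (monomial (\<alpha> \<circ> Transposition.transpose i j)) = Q0 (monomial \<alpha>))"
    by (rule scaled_main_part[OF M(1) odd' square _ ball_subset_if_cube_subset[OF D] \<open>3 * \<delta> > 0\<close> m]) simp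
  have plane: "\<exists>G. cubature_formula D (4 * g) G
      \<and> (\<forall>\<alpha>. total_degree \<alpha> \<le> 7 \<longrightarrow> support \<alpha> = S \<longrightarrow> (\<forall>j. even (\<alpha> j)) \<longrightarrow> G (monomial \<alpha>) = ?I \<alpha> - Q0 (monomial \<alpha>))
      \<and> (\<forall>\<alpha>. \<not> support \<alpha> \<subseteq> S \<or> (\<exists>j. odd (\<alpha> j)) \<longrightarrow> G (monomial \<alpha>) = 0)"
    if S: "card S = 2" for S
  proof -
    obtain i j where ij: "S = {i, j}" "i \<noteq> j" using S by (auto simp: card_2_iff)
    let ?e = "\<lambda>a b l. if l = i then a else if l = j then b else 0"
    let ?R = "\<lambda>a b. ?I (?e a b) - Q0 (monomial (?e a b))"
    have \<alpha>: "\<alpha> = ?e (\<alpha> i) (\<alpha> j)" if "support \<alpha> = {i, j}" for \<alpha>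
    proof
      fix l
      have "l \<in> support \<alpha> \<longleftrightarrow> l = i \<or> l = j" using that by blast
      then show "\<alpha> l = ?e (\<alpha> i) (\<alpha> j) l" by (auto simp: support_def)
    qed
    have "?R 4 2 = ?R 2 4" if eq: "\<forall>i j. m i = m j"
    proof -
      \<comment> \<open>Exchanging the two coordinates turns one mixed moment into the other, for the design as well as for the weight.\<close>
      have swap: "?e 4 2 = ?e 2 4 \<circ> Transposition.transpose i j"
        using ij(2) by (auto simp: fun_eq_iff Transposition.transpose_def)
      have total: "total_degree (?e 2 4) = 6"
        using ij(2) by (simp add: total_degree_def sum.If_cases Compl_eq_Diff_UNIV)
      have "M (monomial (?e 2 4 \<circ> Transposition.transpose i j)) = M (monomial (?e 2 4))"
        unfolding monomial_swap_coords[symmetric]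
        by (rule invariant_on_monomials[OF M(1) inner_swap_coords])
           (simp only: total M(3) power_sum_swap_coords)
      then have "Q0 (monomial (?e 4 2)) = Q0 (monomial (?e 2 4))"
        unfolding swap by (rule Q0(3)[rule_format, OF eq[rule_format]])
      moreover have "?I (?e 4 2) = ?I (?e 2 4)"
      proof -
        have I: "?I \<beta> = (\<Prod>l\<in>UNIV. m i (\<beta> l))" for \<beta>
          using eq by (intro prod.cong refl fun_cong[of "m _"]) blast
        show ?thesis
          unfolding swap I
          by (rule prod.reindex_bij_witness[of _ "Transposition.transpose i j" "Transposition.transpose i j"])
             (use ij(2) in auto)
      qed
      ultimately show ?thesis by simp
    qed
    then have R: "g = 3 \<or> g = 2 \<and> ?R 4 2 = ?R 2 4" using g by blast
    obtain G where G: "cubature_formula D (4 * g) G"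
      "\<forall>\<alpha>. total_degree \<alpha> \<le> 7 \<longrightarrow> support \<alpha> = {i, j} \<longrightarrow> (\<forall>j. even (\<alpha> j)) \<longrightarrow> G (monomial \<alpha>) = ?R (\<alpha> i) (\<alpha> j)"
      "\<forall>\<alpha>. \<not> support \<alpha> \<subseteq> {i, j} \<or> (\<exists>j. odd (\<alpha> j)) \<longrightarrow> G (monomial \<alpha>) = 0"
      using plane_correction[where R = ?R, OF ij(2) \<delta> D R] by (elim exE conjE) (rule that)
    show ?thesis unfolding ij(1)
    proof (intro exI conjI)
      show "\<forall>\<alpha>. total_degree \<alpha> \<le> 7 \<longrightarrow> support \<alpha> = {i, j} \<longrightarrow> (\<forall>j. even (\<alpha> j)) \<longrightarrow>
          G (monomial \<alpha>) = ?I \<alpha> - Q0 (monomial \<alpha>)"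
      proof (intro allI impI)
        fix \<alpha> :: "'d \<Rightarrow> nat"
        assume deg: "total_degree \<alpha> \<le> 7" and supp: "support \<alpha> = {i, j}" and even: "\<forall>j. even (\<alpha> j)"
        show "G (monomial \<alpha>) = ?I \<alpha> - Q0 (monomial \<alpha>)"
          by (rule trans[OF G(2)[rule_format, OF deg supp even[rule_format]]
                arg_cong[OF \<alpha>[OF supp, symmetric], of "\<lambda>\<beta>. ?I \<beta> - Q0 (monomial \<beta>)"]])
      qed
    qed (rule G(1) G(3))+
  qed
  obtain Q1 where Q1: "cubature_formula D (?n + (CARD('d) choose 2) * (4 * g)) Q1"
    "\<forall>\<alpha>. total_degree \<alpha> \<le> 2 * 3 + 1 \<longrightarrow> card (support \<alpha>) \<ge> 2 \<or> (\<exists>j. odd (\<alpha> j)) \<longrightarrow> Q1 (monomial \<alpha>) = ?I \<alpha>"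
    by (rule correct_support_size[OF Q0(1), of "2 * 3 + 1" 2 ?I "4 * g"])
       (use Q0(2) plane in simp_all)
  obtain Q where "cubature_formula D (?n + (CARD('d) choose 2) * (4 * g) + 2 * 3 * CARD('d) + 1) Q"
    "\<forall>\<alpha>. total_degree \<alpha> \<le> 2 * 3 + 1 \<longrightarrow> Q (monomial \<alpha>) = ?I \<alpha>"
    by (rule exact_up_to_axes[OF _ \<delta> D Q1]) simp
  then show thesis by (intro that[of Q]) simp_all
qed

lemma real_choose_2: "real (n choose 2) = real n * (real n - 1) / 2"
  by (cases n) (auto simp: choose_two real_of_nat_div field_simps)

lemma real_choose_3: "real (n choose 3) = real n * (real n - 1) * (real n - 2) / 6"
proof (cases n)
  case (Suc k)
  have "3 * (n choose 3) = n * (k choose 2)"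
    using binomial_absorption[of 2 n] Suc by (simp add: numeral_3_eq_3 numeral_2_eq_2)
  then have "3 * real (n choose 3) = real n * real (k choose 2)"
    by (metis of_nat_mult of_nat_numeral)
  then show ?thesis using Suc by (simp add: real_choose_2 field_simps)
qed simp

theorem theorem1:
  fixes d k :: nat
    and \<Omega> :: "'d::finite \<Rightarrow> real set"
    and \<rho> :: "'d \<Rightarrow> real \<Rightarrow> real"
  assumes "d = CARD('d)"
    and "k \<in> {2, 3}"
    and "k = 2 \<Longrightarrow> d \<ge> 4"
    and "k = 3 \<Longrightarrow> d \<ge> 6"
    and "\<And>j. is_interval (\<Omega> j)"
    and "\<And>j x. x \<in> \<Omega> j \<Longrightarrow> - x \<in> \<Omega> j"
    and "\<And>j x. x \<in> \<Omega> j \<Longrightarrow> \<rho> j x \<ge> 0"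
    and "\<And>j x. x \<in> \<Omega> j \<Longrightarrow> \<rho> j x = \<rho> j (- x)"
    and "\<And>j (p :: real poly). set_integrable lebesgue (\<Omega> j) (\<lambda>x. poly p x * \<rho> j x)"
  shows "(\<exists>n Q. cubature_formula (box_domain \<Omega>) n Q
            \<and> exact_of_degree (2 * k + 1)
                (weighted_integral (box_domain \<Omega>) (product_weight \<rho>)) Q
            \<and> (k = 2 \<longrightarrow> real n \<le> real d ^ 2 + 9 * real d + 1)
            \<and> (k = 3 \<longrightarrow> real n \<le> (real d ^ 3 + 33 * real d ^ 2 + 14 * real d + 3) / 3))
    \<and> ((\<forall>i j. \<Omega> i = \<Omega> j \<and> (\<forall>x\<in>\<Omega> i. \<rho> i x = \<rho> j x)) \<longrightarrow>
         (\<exists>n Q. cubature_formula (box_domain \<Omega>) n Q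
            \<and> exact_of_degree (2 * k + 1)
                (weighted_integral (box_domain \<Omega>) (product_weight \<rho>)) Q
            \<and> (k = 2 \<longrightarrow> real n \<le> real d ^ 2 + 7 * real d + 1)
            \<and> (k = 3 \<longrightarrow> real n \<le> (real d ^ 3 + 21 * real d ^ 2 + 20 * real d + 3) / 3)))"
proof -
  define m where "m j a = moment (\<Omega> j) (\<rho> j) a" for j a
  have int: "set_integrable lebesgue (\<Omega> j) (\<lambda>x. x ^ a * \<rho> j x)" for j a
    using assms(9)[of j "monom 1 a"] by (simp add: poly_monom)
  note monomial = weighted_integral_monomial[of \<Omega> \<rho>, OF int]
  have exact: "exact_of_degree (2 * k + 1) (weighted_integral (box_domain \<Omega>) (product_weight \<rho>)) Q"
    if "cubature_formula (box_domain \<Omega>) n Q"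
      "\<forall>\<alpha>. total_degree \<alpha> \<le> 2 * k + 1 \<longrightarrow> Q (monomial \<alpha>) = (\<Prod>j\<in>UNIV. m j (\<alpha> j))" for Q n
    using that by (intro exact_of_degree_if_monomials[OF that(1) monomial(1)]) (simp add: monomial(2) m_def)
  show ?thesis
  proof (cases "\<exists>j. m j 0 = 0")
    case True
    \<comment> \<open>One weight vanishes almost everywhere: the integral is zero, and no knots are used.\<close>
    then obtain j where j: "m j 0 = 0" by blast
    have zero: "m j a = 0" for a
      unfolding m_def
    proof (rule moment_0_eq_0_imp_all)
      show "set_integrable lebesgue (\<Omega> j) (\<rho> j)" using int[of j 0] by simp
      show "moment (\<Omega> j) (\<rho> j) 0 = 0" using j by (simp add: m_def)
    qed (rule assms(7))
    have "(\<Prod>j\<in>UNIV. m j (\<alpha> j)) = 0" for \<alpha>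
      using zero by (intro prod_zero) auto
    then have "exact_of_degree (2 * k + 1) (weighted_integral (box_domain \<Omega>) (product_weight \<rho>)) (\<lambda>f. 0)"
      by (intro exact[OF cubature_formula_zero]) simp
    then show ?thesis
      by (intro conjI impI exI[of _ 0] exI[of _ "\<lambda>f. 0"] cubature_formula_zero) simp_all
  next
    case False
    have nonneg: "m j a \<ge> 0" if "even a" for j a
      unfolding m_def by (rule moment_even_nonneg) (rule assms(7), assumption, rule that)
    have pos: "\<forall>j. m j 0 > 0"
    proof
      fix j show "m j 0 > 0" using False nonneg[of 0 j] by (simp add: less_le)
    qed
    have m2: "\<forall>j. m j 2 \<ge> 0" using nonneg by simp
    have modd: "\<forall>j a. odd a \<longrightarrow> m j a = 0"
    proof (intro allI impI)
      fix j and a :: nat assume "odd a"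
      then show "m j a = 0"
        unfolding m_def by (intro moment_odd) (rule assms(6), assumption, rule assms(8), assumption+)
    qed
    have "\<exists>\<epsilon>. \<epsilon> > 0 \<and> {-\<epsilon>..\<epsilon>} \<subseteq> \<Omega> j" for j
    proof -
      have nonzero: "moment (\<Omega> j) (\<rho> j) 0 \<noteq> 0" using False by (simp add: m_def)
      have "\<forall>x\<in>\<Omega> j. - x \<in> \<Omega> j" using assms(6) by blast
      then obtain \<epsilon> where "\<epsilon> > 0" "{-\<epsilon>..\<epsilon>} \<subseteq> \<Omega> j"
        by (rule moment_nonzero_imp_interval[OF assms(5) _ nonzero])
      then show ?thesis by blast
    qed
    then obtain \<epsilon> where \<epsilon>: "\<And>j. \<epsilon> j > 0" "\<And>j. {-\<epsilon> j..\<epsilon> j} \<subseteq> \<Omega> j" by metis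
    define \<delta> where "\<delta> = Min (range \<epsilon>) / 3"
    have \<delta>: "\<delta> > 0" using \<epsilon>(1) by (simp add: \<delta>_def)
    have cube: "{x. \<forall>j. \<bar>x $ j\<bar> \<le> 3 * \<delta>} \<subseteq> box_domain \<Omega>"
    proof
      fix x :: "real ^ 'd" assume x: "x \<in> {x. \<forall>j. \<bar>x $ j\<bar> \<le> 3 * \<delta>}"
      have "x $ j \<in> \<Omega> j" for j
      proof -
        have "\<bar>x $ j\<bar> \<le> 3 * \<delta>" using x by blast
        also have "3 * \<delta> \<le> \<epsilon> j" unfolding \<delta>_def by simp
        finally show ?thesis using \<epsilon>(2)[of j] by (auto simp: abs_le_iff)
      qed
      then show "x \<in> box_domain \<Omega>" by (simp add: box_domain_def)
    qed
    consider (five) "k = 2" | (seven) "k = 3" using assms(2) by blast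
    then show ?thesis
    proof cases
      case five
      let ?n = "(CARD('d) choose 2) * 2 + 4 * CARD('d) + 4 * CARD('d) + 1"
      obtain Q where Q: "cubature_formula (box_domain \<Omega>) ?n Q"
        "\<forall>\<alpha>. total_degree \<alpha> \<le> 5 \<longrightarrow> Q (monomial \<alpha>) = (\<Prod>j\<in>UNIV. m j (\<alpha> j))"
        by (rule moment_formula_degree_5[OF \<delta> cube pos m2 modd])
      have n: "real ?n = real d ^ 2 + 7 * real d + 1"
        by (simp add: assms(1) real_choose_2 power2_eq_square field_simps)
      have "exact_of_degree (2 * k + 1) (weighted_integral (box_domain \<Omega>) (product_weight \<rho>)) Q"
        by (rule exact[OF Q(1)]) (use Q(2) five in simp)
      then show ?thesis
        using Q(1) n five by (intro conjI impI exI[of _ ?n] exI[of _ Q]) simp_all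
    next
      case seven
      define N where "N g = (CARD('d) choose 3) * 2 + (CARD('d) choose 2) * 6 + (12 * CARD('d) + 6)
        + (CARD('d) choose 2) * (4 * g) + 6 * CARD('d) + 1" for g
      have formula: "\<exists>Q. cubature_formula (box_domain \<Omega>) (N g) Q
          \<and> exact_of_degree (2 * k + 1) (weighted_integral (box_domain \<Omega>) (product_weight \<rho>)) Q"
        if g: "g = 3 \<or> g = 2 \<and> (\<forall>i j. m i = m j)" for g
      proof -
        obtain Q where Q: "cubature_formula (box_domain \<Omega>) (N g) Q"
          "\<forall>\<alpha>. total_degree \<alpha> \<le> 7 \<longrightarrow> Q (monomial \<alpha>) = (\<Prod>j\<in>UNIV. m j (\<alpha> j))"
          unfolding N_def by (rule moment_formula_degree_7[OF \<delta> cube pos m2 modd g])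
        have "exact_of_degree (2 * k + 1) (weighted_integral (box_domain \<Omega>) (product_weight \<rho>)) Q"
          by (rule exact[OF Q(1)]) (use Q(2) seven in simp)
        with Q(1) show ?thesis by blast
      qed
      have N: "3 * real (N g) = real d ^ 3 + (6 * real g + 6) * real d ^ 2 + (47 - 6 * real g) * real d + 21" for g
        by (simp add: N_def assms(1) real_choose_2 real_choose_3 power2_eq_square power3_eq_cube field_simps)
      have d: "real d \<ge> 6" using assms(4)[OF seven] by simp
      then have d2: "real d ^ 2 \<ge> 6 * real d" by (simp add: power2_eq_square mult_right_mono)
      have "real (N 3) \<le> (real d ^ 3 + 33 * real d ^ 2 + 14 * real d + 3) / 3"
        using N[of 3] d d2 by simp
      moreover have "real (N 2) \<le> (real d ^ 3 + 21 * real d ^ 2 + 20 * real d + 3) / 3"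
        using N[of 2] d d2 by simp
      moreover have "\<forall>i j. m i = m j" if eq: "\<forall>i j. \<Omega> i = \<Omega> j \<and> (\<forall>x\<in>\<Omega> i. \<rho> i x = \<rho> j x)"
      proof (intro allI ext)
        fix i j a
        have "moment (\<Omega> j) (\<rho> i) a = moment (\<Omega> j) (\<rho> j) a" by (rule moment_cong) (use eq in blast)
        moreover have "\<Omega> i = \<Omega> j" using eq by blast
        ultimately show "m i a = m j a" by (simp add: m_def)
      qed
      ultimately show ?thesis
        using formula[of 3] formula[of 2] seven by auto
    qed
  qed
qed

end
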